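(* Let $\mu$ be a singular Borel probability measure on $\mathbb{T}=(-1/2,1/2)$ with support in $[\alpha,\beta]\subset[-1/2,1/2]$, where $\beta-\alpha<1$. Let $b$ be the inner function associated to $\mu$ via the Herglotz representation, and let $\mu_{+}(z)=\int_{\mathbb{T}}\frac{1}{1-ze^{-2\pi i x}}\,d\mu(x)$. Let $F$ be an entire function. Then there exists $f\in L^2(\mu)$ such that $$F(z)=\int_{\mathbb{T}} f(x)e^{-2\pi i x z}\,d\mu(x)\qquad\text{for all } z\in\mathbb{C}$$ if and only if all of the following hold: (i) $F$ is of exponential type; (ii) the indicator function of $F$ satisfies $h_F\left(\frac{\pi}{2}\right)\le 2\pi\beta$ and $h_F\left(-\frac{\pi}{2}\right)\le -2\pi\alpha$; (iii) $$G_F(z):=\frac{\sum_{n=0}^{\infty}F(n)z^n}{\mu_{+}(z)}\in\mathcal{H}(b),$$ i.e. the function $G_F$ is in the kernel of the Toeplitz operator $T_{\overline{b}}$ on $H^2(\mathbb{D})$.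
   Context: The circle $\mathbb{T}$ is identified with $(-1/2,1/2)$ via $x\mapsto e^{2\pi i x}$; it is a standing assumption that $\mu$ gives no mass to the point $1/2$ of the circle. "Singular" means singular with respect to Lebesgue measure. $\mathbb{D}$ is the open unit disc and $H^2=H^2(\mathbb{D})$ the Hardy space. The inner function $b$ associated to $\mu$ via the Herglotz representation is the unique inner function on $\mathbb{D}$ with $\frac{1+b(z)}{1-b(z)}=\int_{\mathbb{T}}\frac{e^{2\pi i x}+z}{e^{2\pi i x}-z}\,d\mu(x)$ for $z\in\mathbb{D}$ (equivalently $\mu_{+}=1/(1-b)$; here $b(0)=0$). The model space is $\mathcal{H}(b)=H^2\ominus bH^2$, the orthogonal complement of $bH^2$ in $H^2$. For $\varphi\in L^\infty$ of the circle, $T_\varphi$ is the Toeplitz operator on $H^2(\mathbb{D})$ with symbol $\varphi$, i.e. $T_\varphi G=P_{H^2}(\varphi G)$; a function $G\in H^2$ lies in $\mathcal{H}(b)$ iff $T_{\overline{b}}G=0$. The function $\mu_{+}$ is analytic and nonvanishing on $\mathbb{D}$. If $1/\mu_{+}(z)=\sum_{n\ge0}\alpha_n z^n$, then $G_F$ is understood as the power series $\sum_{n\ge0}\left(\sum_{j=0}^n\alpha_{n-j}F(j)\right)z^n$, and $G_F\in\mathcal{H}(b)$ means that this is the Taylor series of an element of $\mathcal{H}(b)$. For an entire function $F$ of exponential type, the Phragmén-Lindelöf indicator function is $h_F(\theta)=\limsup_{r\to\infty}\frac{1}{r}\log|F(re^{i\theta})|$ (with value $-\infty$ if $F\equiv0$).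 *)

theory Defs
  imports "HOL-Probability.Probability" "HOL-Complex_Analysis.Complex_Analysis"
begin

text \<open>
  The circle is parametrised by \<open>x \<mapsto> cis (2 * pi * x)\<close> with \<open>-1/2 < x < 1/2\<close>. A measure on the
  circle without mass at the point \<open>x = 1/2\<close> is a Borel measure on the real line that is carried by
  this open interval.
\<close>

definition singular_circle_prob :: "real measure \<Rightarrow> bool" where
  "singular_circle_prob \<mu> \<longleftrightarrow>
     prob_space \<mu> \<and> sets \<mu> = sets borel \<and>
     emeasure \<mu> (- {-1/2<..<1/2}) = 0 \<and>
     (\<exists>N\<in>sets borel. emeasure lborel N = 0 \<and> emeasure \<mu> (- N) = 0)"

definition msupport :: "'a::topological_space measure \<Rightarrow> 'a set" where
  "msupport \<mu> = {x. \<forall>U. open U \<longrightarrow> x \<in> U \<longrightarrow> emeasure \<mu> U > 0}"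

definition in_L2 :: "'a measure \<Rightarrow> ('a \<Rightarrow> complex) \<Rightarrow> bool" where
  "in_L2 M f \<longleftrightarrow> f \<in> borel_measurable M \<and> integrable M (\<lambda>x. (norm (f x))\<^sup>2)"

definition mu_plus :: "real measure \<Rightarrow> complex \<Rightarrow> complex" where
  "mu_plus \<mu> z = (LINT x|\<mu>. 1 / (1 - z * cis (- 2 * pi * x)))"

definition inner_function :: "(complex \<Rightarrow> complex) \<Rightarrow> bool" where
  "inner_function b \<longleftrightarrow>
     b holomorphic_on ball 0 1 \<and> (\<forall>z\<in>ball 0 1. norm (b z) \<le> 1) \<and>
     (AE x in lborel. x \<in> {-1/2<..<1/2} \<longrightarrow>
        (\<exists>l. norm l = 1 \<and> ((\<lambda>r::real. b (of_real r * cis (2 * pi * x))) \<longlongrightarrow> l) (at_left 1)))"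

text \<open>
  On the disc the right-hand side has positive real part, so the equation forces \<open>b z \<noteq> 1\<close>
  (for \<open>b z = 1\<close> the left-hand side would be \<open>0\<close>) and determines \<open>b\<close> there. Values of \<open>b\<close>
  outside the disc are irrelevant throughout.
\<close>

definition herglotz_inner_function :: "real measure \<Rightarrow> (complex \<Rightarrow> complex) \<Rightarrow> bool" where
  "herglotz_inner_function \<mu> b \<longleftrightarrow>
     inner_function b \<and>
     (\<forall>z\<in>ball 0 1. (1 + b z) / (1 - b z) =
        (LINT x|\<mu>. (cis (2 * pi * x) + z) / (cis (2 * pi * x) - z)))"

text \<open>
  The Hardy space of the disc is the space of holomorphic functions with square-summable Taylor
  coefficients, with the corresponding inner product of coefficient sequences.
\<close>

definition hardy_space :: "(complex \<Rightarrow> complex) set" where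
  "hardy_space = {f. f holomorphic_on ball 0 1 \<and>
     summable (\<lambda>n. (norm (fps_nth (fps_expansion f 0) n))\<^sup>2)}"

definition hardy_inner :: "(complex \<Rightarrow> complex) \<Rightarrow> (complex \<Rightarrow> complex) \<Rightarrow> complex" where
  "hardy_inner f g =
     (\<Sum>n. fps_nth (fps_expansion f 0) n * cnj (fps_nth (fps_expansion g 0) n))"

definition model_space :: "(complex \<Rightarrow> complex) \<Rightarrow> (complex \<Rightarrow> complex) set" where
  "model_space b =
     {g \<in> hardy_space. \<forall>h\<in>hardy_space. hardy_inner g (\<lambda>z. b z * h z) = 0}"

text \<open>
  The sequence \<open>F(n)\<close> may grow too fast for its generating function to converge on the disc, so
  the quotient by \<open>mu_plus \<mu>\<close> is the Cauchy product of formal power series.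
\<close>

definition G_series :: "real measure \<Rightarrow> (complex \<Rightarrow> complex) \<Rightarrow> complex fps" where
  "G_series \<mu> F = fps_expansion (\<lambda>z. 1 / mu_plus \<mu> z) 0 * Abs_fps (\<lambda>n. F (of_nat n))"

definition exponential_type :: "(complex \<Rightarrow> complex) \<Rightarrow> bool" where
  "exponential_type F \<longleftrightarrow> (\<exists>C \<tau>. \<forall>z. norm (F z) \<le> C * exp (\<tau> * norm z))"

text \<open>The case distinction implements \<open>log 0 = -\<infinity>\<close>, since \<open>ln 0 = 0\<close> on the reals.\<close>

definition indicator_PL :: "(complex \<Rightarrow> complex) \<Rightarrow> real \<Rightarrow> ereal" where
  "indicator_PL F \<theta> = Limsup at_top (\<lambda>r::real.
     if F (of_real r * cis \<theta>) = 0 then -\<infinity>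
     else ereal (ln (norm (F (of_real r * cis \<theta>))) / r))"

end

theory Submission
  imports Defs "HOL-Real_Asymp.Real_Asymp"
begin

text \<open>
  Write \<open>trig n\<close> for the function \<open>x \<mapsto> cis (2 * pi * n * x)\<close> and \<open>B\<close> for the Taylor series of \<open>b\<close>. The
  Herglotz representation says that \<open>1 - B\<close> is the inverse of the power series of \<open>mu_plus\<close>, whose
  coefficients are the Fourier coefficients of \<open>\<mu>\<close>. Hence, if \<open>F n = \<langle>f, trig n\<rangle>\<close> for all \<open>n\<close>, the
  coefficients of \<open>G_series \<mu> F\<close> are those of the Kaczmarz algorithm for \<open>trig 0, trig 1, \<dots>\<close> in \<open>L\<^sup>2(\<mu>)\<close>;
  they are inner products with fixed trigonometric polynomials and satisfy Bessel's inequality. As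
  \<open>b\<close> is inner, multiplication by \<open>b\<close> is isometric on \<open>H\<^sup>2\<close>, and a computation with power series
  shows that the image of each \<open>trig m\<close> is orthogonal to \<open>b H\<^sup>2\<close>. This gives membership in the model
  space by approximation. Conversely, the adjoint of the coefficient map sends an element of the
  model space to some \<open>f\<close> with \<open>\<langle>f, trig n\<rangle> = F n\<close> for all \<open>n\<close>. The transform of \<open>f\<close> and \<open>F\<close> agree at
  the natural numbers and have indicators in a strip of width less than \<open>2 * pi\<close>, so they are equal
  by Carlson's theorem.
\<close>

section \<open>The theorems of Phragmen-Lindelof and Carlson\<close>

text \<open>The map from f to the coefficients of \<open>G_series\<close> is Clark's normalised
  Cauchy transform: the Cauchy transform of f d\<mu>, divided by that of \<mu>. After the radial
  limits of b have been used, everything in H^2 is done with coefficient sequences; that b is inner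
  then means that the series of z^j b(z) are orthonormal. Bessel's inequality enters twice, directly
  and by duality. The dual form makes combinations of the polynomials that represent the
  coefficients converge in L^2(\<mu>), which constructs f from an element of the model space. The
  approximation behind membership in the model space is applied to z^n b(z), not to f: the partial
  sums of its series, pulled back to L^2(\<mu>), converge to a vector that lies in the closed span
  of the \<open>trig j\<close> and is orthogonal to all of them, hence to 0. This settles all f at
  once. Condition (iii) sees only the values F(n) with n \<ge> 0, so (i) and (ii) must determine F
  from them. Here \<beta> - \<alpha> < 1 is the right threshold: sin (pi z) vanishes at all integers
  and has indicator pi in both directions +-pi/2, which corresponds to total width 2 pi.\<close>

lemma powr_beats_linear:
  fixes p :: real
  assumes "p > 1" "c > 0" "M > 0"
  shows "\<exists>R>0. \<forall>r\<ge>R. C * exp (\<tau> * r - c * r powr p) \<le> M"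
proof -
  have "((\<lambda>r. C * exp (\<tau> * r - c * r powr p)) \<longlongrightarrow> 0) at_top"
    using assms by real_asymp
  then have "eventually (\<lambda>r. C * exp (\<tau> * r - c * r powr p) < M) at_top"
    using assms by (auto dest: order_tendstoD)
  then obtain N where N: "\<And>r. r \<ge> N \<Longrightarrow> C * exp (\<tau> * r - c * r powr p) < M"
    by (auto simp: eventually_at_top_linorder)
  then show ?thesis
    by (intro exI[of _ "max 1 N"]) (auto intro: less_imp_le)
qed

text \<open>The half-opening \<open>arctan t\<close> is below pi / 2, so for some p > 1 the power
  z^p has real part at least c |z|^p on the sector, with c > 0. The factor exp (-\<epsilon> z^p)
  suppresses exponential growth on large arcs without enlarging f on the edges; the maximum
  principle gives the bound up to a factor that tends to 1 with \<epsilon> tending to 0. Describing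
  the sector by its slope lets the slope be tuned in \<open>carlson\<close>.\<close>

lemma phragmen_lindelof_sector:
  fixes f :: "complex \<Rightarrow> complex" and t :: real
  defines "S \<equiv> {z. \<bar>Im z\<bar> \<le> t * Re z}"
  assumes t: "t > 0" and hol: "f holomorphic_on S" and M: "M > 0"
    and growth: "\<And>z. z \<in> S \<Longrightarrow> norm (f z) \<le> C * exp (\<tau> * norm z)"
    and bdry: "\<And>z. \<bar>Im z\<bar> = t * Re z \<Longrightarrow> norm (f z) \<le> M"
    and z: "z \<in> S"
  shows "norm (f z) \<le> M"
proof -
  define \<gamma> where "\<gamma> = arctan t"
  have \<gamma>: "0 < \<gamma>" "\<gamma> < pi / 2"
    using t by (auto simp: \<gamma>_def arctan_ubound simp del: divide_const_simps less_divide_eq_numeral1)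
  \<comment> \<open>The exponent \<open>p > 1\<close> makes \<open>exp (- \<epsilon> * z powr p)\<close> beat \<open>exp (\<tau> * norm z)\<close> on the sector.\<close>
  define p where "p = (1 + pi / (2 * \<gamma>)) / 2"
  have p: "p > 1" "p * \<gamma> < pi / 2"
    using \<gamma> by (auto simp: p_def field_simps)
  define c where "c = cos (p * \<gamma>)"
  have c: "c > 0"
    unfolding c_def using p \<gamma> by (intro cos_gt_zero) auto
  have SRe: "Re w \<ge> 0" if "w \<in> S" for w
  proof -
    have "0 \<le> t * Re w" using that unfolding S_def by simp
    then show ?thesis using t by (simp add: zero_le_mult_iff)
  qed
  have SRe': "Re w > 0" if "w \<in> S" "w \<noteq> 0" for w
    using SRe[OF that(1)] that by (cases "Re w = 0") (auto simp: S_def complex_eq_iff)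
  have Re_powr: "Re (w powr of_real p) \<ge> c * norm w powr p" if "w \<in> S" for w
  proof (cases "w = 0")
    case False
    have "\<bar>Im w / Re w\<bar> \<le> t"
      using that SRe'[OF that False] by (simp add: S_def abs_divide pos_divide_le_eq)
    then have "- t \<le> Im w / Re w" "Im w / Re w \<le> t" by linarith+
    then have "arctan (- t) \<le> arctan (Im w / Re w)" "arctan (Im w / Re w) \<le> arctan t"
      by (simp_all only: arctan_le_iff)
    then have "\<bar>arctan (Im w / Re w)\<bar> \<le> \<gamma>"
      unfolding \<gamma>_def arctan_minus by linarith
    then have "\<bar>Arg w\<bar> \<le> \<gamma>"
      using arg_conv_arctan[of w] SRe'[OF that False] by simp
    then have "\<bar>p * Arg w\<bar> \<le> p * \<gamma>"
      using p by (simp add: abs_mult)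
    then have "c \<le> cos \<bar>p * Arg w\<bar>"
      unfolding c_def using p \<gamma> by (intro cos_monotone_0_pi_le) auto
    moreover have "Re (w powr of_real p) = norm w powr p * cos (p * Arg w)"
      using False by (simp add: powr_def Re_exp Arg_eq_Im_Ln)
    ultimately show ?thesis
      by (simp add: mult.commute[of c] mult_left_mono)
  qed simp
  have closedS: "closed S"
    unfolding S_def by (intro closed_Collect_le continuous_intros)
  \<comment> \<open>The vertex is not an interior point, so the interior avoids the branch cut of
    \<open>powr\<close>.\<close>
  have intS: "w \<in> S \<and> w \<noteq> 0" if "w \<in> interior S" for w
  proof
    show "w \<in> S" using that interior_subset by blast
    have "\<not> (\<exists>e>0. ball 0 e \<subseteq> S)"
    proof safe
      fix e :: real assume e: "e > 0" "ball 0 e \<subseteq> S"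
      then have "of_real (- e / 2) \<in> S" by (auto simp: subset_iff)
      from SRe[OF this] e show False by simp
    qed
    then show "w \<noteq> 0" using that by (auto simp: mem_interior)
  qed
  have bound: "norm (f z) \<le> M * exp (\<epsilon> * norm (z powr of_real p))" if \<epsilon>: "\<epsilon> > 0" for \<epsilon>
  proof -
    define g where "g w = f w * exp (- of_real \<epsilon> * w powr of_real p)" for w
    have g_le: "norm (g w) \<le> norm (f w) * exp (- \<epsilon> * c * norm w powr p)" if "w \<in> S" for w
      using mult_left_mono[OF Re_powr[OF that], of \<epsilon>] \<epsilon> by (auto simp: g_def norm_mult mult.assoc intro!: mult_left_mono)
    obtain R0 where R0: "R0 > 0" "\<And>r. r \<ge> R0 \<Longrightarrow> C * exp (\<tau> * r - (\<epsilon> * c) * r powr p) \<le> M"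
      using powr_beats_linear[of p "\<epsilon> * c" M C \<tau>] p c \<epsilon> M by auto
    \<comment> \<open>The arc must be far enough out for the bound \<open>M\<close>, and the
      truncated sector must contain \<open>z\<close>.\<close>
    define R where "R = max R0 (norm z)"
    have "norm (g z) \<le> M"
    proof (rule maximum_modulus_frontier[where f = g and S = "S \<inter> cball 0 R"])
      show "g holomorphic_on interior (S \<inter> cball 0 R)"
        unfolding g_def
      proof (intro holomorphic_intros)
        show "f holomorphic_on interior (S \<inter> cball 0 R)"
          using hol by (rule holomorphic_on_subset) (use interior_subset in blast)
        fix w assume w: "w \<in> interior (S \<inter> cball 0 R)"
        then have "w \<in> interior S" by simp
        then show "w \<notin> \<real>\<^sub>\<le>\<^sub>0"
          using intS[of w] SRe'[of w] by (auto simp: complex_nonpos_Reals_iff)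
      qed
      have cf: "continuous_on S f"
        using hol by (rule holomorphic_on_imp_continuous_on)
      have cl: "closure (S \<inter> cball 0 R) = S \<inter> cball 0 R"
        using closedS by (intro closure_closed closed_Int) auto
      \<comment> \<open>The vertex lies on the branch cut; there continuity comes from |w^p| = |w|^p
        tending to 0.\<close>
      have cp: "continuous_on S (\<lambda>w. w powr of_real p)"
        unfolding continuous_on_eq_continuous_within
      proof
        fix w assume w: "w \<in> S"
        show "continuous (at w within S) (\<lambda>w. w powr of_real p)"
        proof (cases "w = 0")
          case True
          have "((\<lambda>w. norm (w powr complex_of_real p)) \<longlongrightarrow> 0) (at 0 within S)"
          proof -
            have "((\<lambda>w::complex. norm w powr p) \<longlongrightarrow> norm (0::complex) powr p) (at 0 within S)"
              using p by (intro tendsto_powr' tendsto_norm tendsto_ident_at tendsto_const) auto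
            moreover have "norm (w powr complex_of_real p) = norm w powr p" for w :: complex
              by (cases "w = 0") (simp_all add: norm_powr_real_powr')
            ultimately show ?thesis using p by simp
          qed
          then show ?thesis
            using True unfolding continuous_within by (simp add: tendsto_norm_zero_iff)
        next
          case False
          with SRe'[OF w] show ?thesis
            unfolding continuous_within
            by (intro tendsto_intros) (auto simp: complex_nonpos_Reals_iff)
        qed
      qed
      show "continuous_on (closure (S \<inter> cball 0 R)) g"
        unfolding cl g_def
        by (intro continuous_on_mult continuous_on_exp continuous_on_const
          continuous_on_subset[OF cf] continuous_on_subset[OF cp]) auto
      show "bounded (S \<inter> cball 0 R)" by (simp add: bounded_Int)
      show "z \<in> S \<inter> cball 0 R" using z by (auto simp: R_def)
      fix w assume w: "w \<in> frontier (S \<inter> cball 0 R)"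
      then have wS: "w \<in> S" "norm w \<le> R"
        using cl by (auto simp: frontier_def)
      show "norm (g w) \<le> M"
      proof (cases "norm w = R")
        case True
        have "norm (g w) \<le> C * exp (\<tau> * norm w) * exp (- \<epsilon> * c * norm w powr p)"
          by (rule order_trans[OF g_le[OF wS(1)] mult_right_mono[OF growth[OF wS(1)]]]) simp
        also have "\<dots> = C * exp (\<tau> * norm w - (\<epsilon> * c) * norm w powr p)"
          by (simp add: mult.assoc mult_exp_exp)
        also have "\<dots> \<le> M" using R0(2)[of "norm w"] True by (simp add: R_def)
        finally show ?thesis .
      next
        case False
        have "\<bar>Im w\<bar> = t * Re w"
        proof (rule ccontr)
          assume "\<bar>Im w\<bar> \<noteq> t * Re w"
          with wS False have "w \<in> {w. \<bar>Im w\<bar> < t * Re w} \<inter> ball 0 R"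
            by (auto simp: S_def)
          moreover have "open ({w. \<bar>Im w\<bar> < t * Re w} \<inter> ball 0 R)"
            by (intro open_Int open_Collect_less continuous_intros) auto
          moreover have "{w. \<bar>Im w\<bar> < t * Re w} \<inter> ball 0 R \<subseteq> S \<inter> cball 0 R"
            by (auto simp: S_def)
          ultimately have "w \<in> interior (S \<inter> cball 0 R)" by (meson interiorI)
          with w show False by (simp add: frontier_def)
        qed
        from bdry[OF this] have "norm (f w) \<le> M" .
        moreover have "norm (g w) \<le> norm (f w)"
          by (rule order_trans[OF g_le[OF wS(1)] mult_left_le]) (use \<epsilon> c in auto)
        ultimately show ?thesis by linarith
      qed
    qed
    moreover have "f z = g z * exp (of_real \<epsilon> * z powr of_real p)"
      by (simp add: g_def exp_minus)
    moreover have "norm (exp (of_real \<epsilon> * z powr of_real p)) \<le> exp (\<epsilon> * norm (z powr of_real p))"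
      using \<epsilon> complex_Re_le_cmod[of "z powr of_real p"] by simp
    ultimately show ?thesis
      using M by (simp only: norm_mult) (rule mult_mono, auto)
  qed
  have "((\<lambda>\<epsilon>. M * exp (\<epsilon> * norm (z powr of_real p))) \<longlongrightarrow> M * exp (0 * norm (z powr of_real p))) (at_right 0)"
    by (intro tendsto_intros)
  then have "norm (f z) \<le> M * exp (0 * norm (z powr of_real p))"
    by (rule tendsto_lowerbound) (auto intro: eventually_mono[OF eventually_at_right_less] bound)
  then show ?thesis by simp
qed

text \<open>The right-hand side without \<open>C\<close> is the modulus of exp (a z) for the
  \<open>a\<close> below. Dividing by this exponential leaves a function bounded by \<open>C\<close>
  on both edges, and the opening pi / 2 is small enough for Phragmen-Lindelof with exponential
  growth.\<close>

lemma quadrant_bound: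
  fixes F :: "complex \<Rightarrow> complex"
  assumes hol: "F holomorphic_on UNIV" and C: "C > 0" and \<tau>: "\<tau> \<ge> 0"
    and growth: "\<And>z. norm (F z) \<le> C * exp (\<tau> * norm z)"
    and axis: "\<And>y. y \<ge> 0 \<Longrightarrow> norm (F (\<i> * of_real y)) \<le> C * exp (\<kappa> * y)"
    and z: "Re z \<ge> 0" "Im z \<ge> 0"
  shows "norm (F z) \<le> C * exp (\<tau> * Re z + \<kappa> * Im z)"
proof -
  define a where "a = of_real \<tau> - \<i> * of_real \<kappa>"
  define g where "g = (\<lambda>w. F w * exp (- (a * w)))"
  have norm_g: "norm (g w) = norm (F w) * exp (- (\<tau> * Re w + \<kappa> * Im w))" for w
    by (simp add: g_def a_def norm_mult algebra_simps)
  \<comment> \<open>\<open>w \<mapsto> (1 + \<i>) * w\<close> maps the sector \<open>\<bar>Im w\<bar> \<le> Re w\<close> onto the first quadrant.\<close>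
  define f where "f = (\<lambda>w. g ((1 + \<i>) * w))"
  \<comment> \<open>The growth constant is crude: \<open>F\<close> contributes \<tau>, the
    exponential factor at most \<tau> + \<bar>\<kappa>\<bar>, and the substitution scales norms by
    \<open>norm (1 + \<i>)\<close>.\<close>
  have "norm (f (z / (1 + \<i>))) \<le> C"
  proof (rule phragmen_lindelof_sector[where f = f and t = 1 and C = C
        and \<tau> = "(2 * \<tau> + \<bar>\<kappa>\<bar>) * norm (1 + \<i>)"])
    have "g holomorphic_on UNIV"
      unfolding g_def by (intro holomorphic_intros hol)
    then have "(g \<circ> (\<lambda>w. (1 + \<i>) * w)) holomorphic_on UNIV"
      by (intro holomorphic_on_compose_gen[where t = UNIV] holomorphic_intros) auto
    then show "f holomorphic_on {z. \<bar>Im z\<bar> \<le> 1 * Re z}"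
      unfolding f_def o_def by (rule holomorphic_on_subset) auto
    show "norm (f w) \<le> C * exp ((2 * \<tau> + \<bar>\<kappa>\<bar>) * norm (1 + \<i>) * norm w)" for w
    proof -
      define v where "v = (1 + \<i>) * w"
      have "- (\<tau> * Re v + \<kappa> * Im v) \<le> (\<tau> + \<bar>\<kappa>\<bar>) * norm v"
      proof -
        have "- (\<tau> * Re v) \<le> \<tau> * norm v"
          using mult_left_mono[of "- Re v" "norm v" \<tau>] abs_Re_le_cmod[of v] \<tau> by auto
        moreover have "- (\<kappa> * Im v) \<le> \<bar>\<kappa>\<bar> * norm v"
          using mult_left_mono[OF abs_Im_le_cmod[of v], of "\<bar>\<kappa>\<bar>"] abs_ge_minus_self[of "\<kappa> * Im v"]
          by (simp add: abs_mult)
        ultimately show ?thesis by (simp add: algebra_simps)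
      qed
      then have "norm (g v) \<le> C * exp (\<tau> * norm v) * exp ((\<tau> + \<bar>\<kappa>\<bar>) * norm v)"
        unfolding norm_g using growth[of v] C by (intro mult_mono) auto
      also have "\<dots> = C * exp ((2 * \<tau> + \<bar>\<kappa>\<bar>) * norm v)"
        by (simp add: mult.assoc mult_exp_exp algebra_simps)
      finally show ?thesis
        by (simp add: f_def v_def norm_mult mult.assoc)
    qed
    show "norm (f w) \<le> C" if "\<bar>Im w\<bar> = 1 * Re w" for w
    proof -
      define v where "v = (1 + \<i>) * w"
      have *: "norm (g v) \<le> C"
      proof (cases "Im w \<ge> 0")
        case True
        with that have v: "v = \<i> * of_real (Im v)" "Im v \<ge> 0" "Re v = 0"
          by (auto simp: v_def complex_eq_iff)
        have "norm (g v) = norm (F v) * exp (- (\<kappa> * Im v))"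
          using v(3) by (simp add: norm_g)
        also have "\<dots> \<le> C * exp (\<kappa> * Im v) * exp (- (\<kappa> * Im v))"
          using axis[OF v(2)] v(1) by (intro mult_right_mono) auto
        finally show ?thesis by (simp add: mult.assoc mult_exp_exp)
      next
        case False
        with that have v: "v = of_real (Re v)" "Re v \<ge> 0" "Im v = 0"
          by (auto simp: v_def complex_eq_iff)
        have nv: "norm v = Re v"
          using v by (metis norm_of_real abs_of_nonneg)
        have "norm (g v) \<le> C * exp (\<tau> * Re v) * exp (- (\<tau> * Re v))"
          using growth[of v] v(3) unfolding norm_g nv by (intro mult_mono) (auto simp: C less_imp_le)
        then show ?thesis by (simp add: mult.assoc mult_exp_exp)
      qed
      then show ?thesis by (simp add: f_def v_def)
    qed
    show "z / (1 + \<i>) \<in> {z. \<bar>Im z\<bar> \<le> 1 * Re z}"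
      using z by (simp add: Re_divide Im_divide)
  qed (use C in auto)
  then have "norm (g z) \<le> C"
    by (simp add: f_def complex_eq_iff)
  then have "norm (F z) * exp (- (\<tau> * Re z + \<kappa> * Im z)) * exp (\<tau> * Re z + \<kappa> * Im z)
      \<le> C * exp (\<tau> * Re z + \<kappa> * Im z)"
    unfolding norm_g by (intro mult_right_mono) auto
  then show ?thesis
    by (simp only: mult.assoc mult_exp_exp) simp
qed

text \<open>The lower quadrant is reduced to the upper one by the reflection cnj (F (cnj z)), which
  is again entire.\<close>

lemma half_plane_bound:
  fixes F :: "complex \<Rightarrow> complex"
  assumes hol: "F holomorphic_on UNIV" and C: "C > 0" and \<tau>: "\<tau> \<ge> 0"
    and growth: "\<And>z. norm (F z) \<le> C * exp (\<tau> * norm z)"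
    and axis: "\<And>y. norm (F (\<i> * of_real y)) \<le> C * exp (\<kappa> * \<bar>y\<bar>)"
    and z: "Re z \<ge> 0"
  shows "norm (F z) \<le> C * exp (\<tau> * Re z + \<kappa> * \<bar>Im z\<bar>)"
proof (cases "Im z \<ge> 0")
  case True
  have "norm (F z) \<le> C * exp (\<tau> * Re z + \<kappa> * Im z)"
    by (rule quadrant_bound[where F = F, OF hol C \<tau> growth _ z True]) (metis axis abs_of_nonneg)
  then show ?thesis using True by simp
next
  case False
  define F' where "F' = (\<lambda>z. cnj (F (cnj z)))"
  have "norm (F' (cnj z)) \<le> C * exp (\<tau> * Re (cnj z) + \<kappa> * Im (cnj z))"
  proof (rule quadrant_bound[where F = F', OF _ C \<tau>])
    have "(cnj \<circ> F \<circ> cnj) holomorphic_on UNIV"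
      by (rule holomorphic_on_compose_cnj_cnj) (use hol in auto)
    then show "F' holomorphic_on UNIV" by (simp add: F'_def o_def)
    show "norm (F' w) \<le> C * exp (\<tau> * norm w)" for w
      using growth[of "cnj w"] by (simp add: F'_def)
    show "norm (F' (\<i> * of_real y)) \<le> C * exp (\<kappa> * y)" if "y \<ge> 0" for y
      using axis[of "- y"] that by (simp add: F'_def)
  qed (use z False in auto)
  then show ?thesis using False by (simp add: F'_def)
qed

section \<open>Division by the sine and Carlson's theorem\<close>

lemma sin_pi_eq_0_iff: "sin (of_real pi * z) = 0 \<longleftrightarrow> (\<exists>n::int. z = of_int n)" for z :: complex
  by (subst sin_eq_0) (auto simp: mult.commute)

text \<open>The zeros of sin (pi z) are simple, so the zeros of \<open>F\<close> make the
  singularities of the quotient removable. The half-plane stops at -1 because nothing is assumed of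
  \<open>F\<close> at negative integers, yet it reaches past the imaginary axis so as to contain the
  box around 0 to which \<open>quotient_bound\<close> applies the maximum principle.\<close>

lemma divide_by_sin:
  fixes F :: "complex \<Rightarrow> complex"
  assumes hol: "F holomorphic_on UNIV" and zeros: "\<And>n::nat. F (of_nat n) = 0"
  obtains \<phi> where "\<phi> holomorphic_on {z. Re z > -1}"
    and "\<And>z. Re z > -1 \<Longrightarrow> \<phi> z * sin (of_real pi * z) = F z"
proof -
  define s where "s = (\<lambda>z::complex. sin (of_real pi * z))"
  \<comment> \<open>The values at the zeros of the sine are those of l'Hospital's rule.\<close>
  define \<phi> where "\<phi> = (\<lambda>z. if s z = 0 then deriv F z / (of_real pi * cos (of_real pi * z)) else F z / s z)"
  have s_hol: "s holomorphic_on A" for A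
    unfolding s_def by (intro holomorphic_intros)
  have s_deriv: "deriv s z = of_real pi * cos (of_real pi * z)" for z
    unfolding s_def by (rule DERIV_imp_deriv) (auto intro!: derivative_eq_intros)
  have F_hol: "F holomorphic_on A" for A
    using hol by (rule holomorphic_on_subset) auto
  have \<phi>1: "\<phi> holomorphic_on {z. s z \<noteq> 0}"
    by (rule holomorphic_transform[of "\<lambda>z. F z / s z"])
       (auto simp: \<phi>_def intro!: holomorphic_intros s_hol F_hol)
  have op1: "open {z. s z \<noteq> 0}"
    unfolding s_def by (intro open_Collect_neq continuous_intros)
  have cosn: "cos (of_real pi * of_nat n) \<noteq> (0::complex)" for n
    using sin_cos_squared_add[of "of_real pi * of_nat n :: complex"] sin_pi_eq_0_iff[of "of_nat n"]
    by (metis add.left_neutral of_int_of_nat_eq power_zero_numeral zero_neq_one)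
  have \<phi>2: "\<phi> holomorphic_on ball (of_nat n) 1" for n
  proof -
    define a :: complex where "a = of_nat n"
    have sa: "s a = 0" using sin_pi_eq_0_iff[of a] by (auto simp: s_def a_def intro: exI[of _ "int n"])
    have s_nz: "s z \<noteq> 0" if "z \<in> ball a 1" "z \<noteq> a" for z
    proof
      assume "s z = 0"
      then obtain k where k: "z = of_int k" using sin_pi_eq_0_iff by (auto simp: s_def)
      have "norm (of_int (int n - k) :: complex) < 1"
        using that by (simp add: k a_def dist_norm)
      then have "\<bar>int n - k\<bar> < 1" unfolding norm_of_int by linarith
      then show False using that k by (auto simp: a_def)
    qed
    \<comment> \<open>Cancelling z - a from \<open>F\<close> and from \<open>s\<close> leaves
      holomorphic \<open>h\<close> and \<open>t\<close>, where \<open>t\<close> has no zero; their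
      quotient is \<phi> on the disc.\<close>
    define h where "h = (\<lambda>z. if z = a then deriv F a else F z / (z - a))"
    define t where "t = (\<lambda>z. if z = a then deriv s a else s z / (z - a))"
    have "h holomorphic_on ball a 1"
      by (rule pole_theorem_open_0[OF F_hol open_ball, of a]) (auto simp: h_def a_def zeros)
    moreover have "t holomorphic_on ball a 1"
      by (rule pole_theorem_open_0[OF s_hol open_ball, of a]) (auto simp: t_def sa)
    moreover have "t z \<noteq> 0" if "z \<in> ball a 1" for z
      using s_nz[OF that] cosn[of n] by (auto simp: t_def s_deriv a_def)
    ultimately have "(\<lambda>z. h z / t z) holomorphic_on ball a 1"
      by (intro holomorphic_intros) auto
    then show ?thesis
      unfolding a_def[symmetric]
      by (rule holomorphic_transform) (use s_nz sa in \<open>auto simp: \<phi>_def h_def t_def s_deriv\<close>)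
  qed
  have "\<phi> holomorphic_on {z. s z \<noteq> 0} \<union> (\<Union>n. ball (of_nat n) 1)"
    using \<phi>1 \<phi>2 op1 by (intro holomorphic_on_Un holomorphic_on_UN_open) auto
  moreover have sub: "\<exists>n. z = of_nat n" if z: "Re z > -1" "s z = 0" for z
  proof -
    obtain k :: int where k: "z = of_int k"
      using z(2) sin_pi_eq_0_iff[of z] by (auto simp: s_def)
    with z(1) have "z = of_nat (nat k)" by simp
    then show ?thesis ..
  qed
  have "{z. Re z > -1} \<subseteq> {z. s z \<noteq> 0} \<union> (\<Union>n. ball (of_nat n) 1)"
  proof
    fix z assume "z \<in> {z. Re z > -1}"
    then show "z \<in> {z. s z \<noteq> 0} \<union> (\<Union>n. ball (of_nat n) 1)"
      using sub[of z] by (cases "s z = 0") (auto, metis dist_self zero_less_one)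
  qed
  ultimately have "\<phi> holomorphic_on {z. Re z > -1}" by (rule holomorphic_on_subset)
  moreover have "\<phi> z * sin (of_real pi * z) = F z" if "Re z > -1" for z
    using sub[OF that] zeros by (auto simp: \<phi>_def s_def)
  ultimately show ?thesis by (rule that)
qed

lemma norm_sin_pi_ge: "(exp (pi * \<bar>Im z\<bar>) - exp (- (pi * \<bar>Im z\<bar>))) / 2 \<le> norm (sin (of_real pi * z))"
proof -
  define w where "w = of_real pi * z"
  have "norm (sin w) = norm (exp (\<i> * w) - exp (- (\<i> * w))) / 2"
    by (simp add: sin_exp_eq norm_divide norm_mult)
  moreover have "norm (exp (\<i> * w)) = exp (- (pi * Im z))" "norm (exp (- (\<i> * w))) = exp (pi * Im z)"
    by (simp_all add: w_def)
  moreover have "norm (exp (\<i> * w)) - norm (exp (- (\<i> * w))) \<le> norm (exp (\<i> * w) - exp (- (\<i> * w)))"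
    "norm (exp (- (\<i> * w))) - norm (exp (\<i> * w)) \<le> norm (exp (\<i> * w) - exp (- (\<i> * w)))"
    by (metis norm_triangle_ineq2) (metis norm_triangle_ineq2 norm_minus_commute)
  ultimately show ?thesis
    unfolding w_def[symmetric] by (cases "Im z \<ge> 0") auto
qed

lemma norm_sin_pi_ge_exp:
  assumes "\<bar>Im z\<bar> \<ge> 1"
  shows "exp (pi * \<bar>Im z\<bar>) / 4 \<le> norm (sin (of_real pi * z))"
proof -
  have "pi * \<bar>Im z\<bar> \<ge> 3 * 1"
    using assms pi_gt3 by (intro mult_mono) auto
  then have "exp (pi * \<bar>Im z\<bar>) \<ge> 2"
    using exp_ge_add_one_self[of "pi * \<bar>Im z\<bar>"] by linarith
  moreover from this have "exp (- (pi * \<bar>Im z\<bar>)) \<le> 1 / 2"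
    by (simp add: exp_minus inverse_eq_divide divide_simps)
  ultimately show ?thesis
    using norm_sin_pi_ge[of z] by argo
qed

text \<open>On these lines the real part of the sine is +-cosh (pi Im z). They carry the vertical
  sides of the boxes in \<open>quotient_bound\<close>.\<close>

lemma norm_sin_pi_ge_1:
  fixes n :: nat
  assumes "\<bar>Re z - n\<bar> = 1 / 2"
  shows "1 \<le> norm (sin (of_real pi * z))"
proof -
  have "pi * Re z = pi * n + pi / 2 \<or> pi * Re z = pi * n - pi / 2"
    using assms by (auto simp: abs_if field_simps split: if_splits)
  then have "\<bar>sin (pi * Re z)\<bar> = 1"
    by (auto simp: sin_add sin_diff)
  moreover have "Re (sin (of_real pi * z)) = sin (pi * Re z) * (exp (pi * Im z) + exp (- (pi * Im z))) / 2"
    by (simp add: Re_sin)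
  moreover have "exp (pi * Im z) + exp (- (pi * Im z)) \<ge> 2"
    using cosh_real_ge_1[of "pi * Im z"] by (simp add: cosh_def)
  ultimately have "\<bar>Re (sin (of_real pi * z))\<bar> \<ge> 1"
    by (simp only: abs_divide abs_mult) simp
  then show ?thesis using abs_Re_le_cmod order_trans by blast
qed

text \<open>For |Im z| \<ge> 1 the sine is at least exp (pi |Im z|) / 4, and
  \<open>half_plane_bound\<close> can be divided by it. Near the real axis the sine has zeros, so
  the bound is transported from the boundary of a box centred at a nearest integer, where the sine
  is at least 1/4.\<close>

lemma quotient_bound:
  fixes F \<phi> :: "complex \<Rightarrow> complex"
  assumes hol: "F holomorphic_on UNIV" and C: "C > 0" and \<tau>: "\<tau> \<ge> 0" and \<kappa>: "\<kappa> < pi"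
    and growth: "\<And>z. norm (F z) \<le> C * exp (\<tau> * norm z)"
    and axis: "\<And>y. norm (F (\<i> * of_real y)) \<le> C * exp (\<kappa> * \<bar>y\<bar>)"
    and \<phi>: "\<phi> holomorphic_on {z. Re z > -1}"
    and quot: "\<And>z. Re z > -1 \<Longrightarrow> \<phi> z * sin (of_real pi * z) = F z"
    and z: "Re z \<ge> 0"
  shows "norm (\<phi> z) \<le> 4 * C * exp (2 * \<tau> + (pi - \<kappa>)) * exp (\<tau> * Re z - (pi - \<kappa>) * \<bar>Im z\<bar>)"
proof -
  have le: "norm (\<phi> w) \<le> 4 * B" if "Re w > -1" "norm (F w) \<le> B * e" "e / 4 \<le> norm (sin (of_real pi * w))" "e > 0" for w B e
  proof -
    have "norm (\<phi> w) * (e / 4) \<le> norm (\<phi> w) * norm (sin (of_real pi * w))"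
      using that by (intro mult_left_mono) auto
    also have "\<dots> \<le> B * e"
      using that quot[of w] by (simp flip: norm_mult)
    finally show ?thesis using \<open>e > 0\<close> by (simp add: field_simps)
  qed
  show ?thesis
  proof (cases "\<bar>Im z\<bar> \<ge> 1")
    case True
    have "norm (\<phi> z) \<le> 4 * (C * exp (\<tau> * Re z - (pi - \<kappa>) * \<bar>Im z\<bar>))"
    proof (rule le[where e = "exp (pi * \<bar>Im z\<bar>)"])
      have "norm (F z) \<le> C * exp (\<tau> * Re z + \<kappa> * \<bar>Im z\<bar>)"
        using half_plane_bound[OF hol C \<tau> growth axis z] .
      then show "norm (F z) \<le> C * exp (\<tau> * Re z - (pi - \<kappa>) * \<bar>Im z\<bar>) * exp (pi * \<bar>Im z\<bar>)"
        by (simp add: mult.assoc mult_exp_exp algebra_simps)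
    qed (use z norm_sin_pi_ge_exp[OF True] in auto)
    also have "\<dots> \<le> 4 * (C * exp (\<tau> * Re z - (pi - \<kappa>) * \<bar>Im z\<bar>)) * exp (2 * \<tau> + (pi - \<kappa>))"
      using C \<tau> \<kappa> mult_left_mono[of 1 "exp (2 * \<tau> + (pi - \<kappa>))" "4 * (C * exp (\<tau> * Re z - (pi - \<kappa>) * \<bar>Im z\<bar>))"]
      by simp
    finally show ?thesis by (simp add: mult_ac)
  next
    case False
    define n where "n = nat \<lfloor>Re z + 1 / 2\<rfloor>"
    have n: "\<bar>Re z - n\<bar> \<le> 1 / 2"
    proof -
      have "real n = of_int \<lfloor>Re z + 1 / 2\<rfloor>" using z by (simp add: n_def)
      then show ?thesis by linarith
    qed
    define S where "S = {w. \<bar>Re w - n\<bar> \<le> 1 / 2 \<and> \<bar>Im w\<bar> \<le> 1}"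
    have S_sub: "S \<subseteq> {w. Re w > -1}" 
  proof
    fix w assume "w \<in> S"
    then have "\<bar>Re w - n\<bar> \<le> 1 / 2" by (simp add: S_def)
    then have "Re w > -1" using of_nat_0_le_iff[of n, where 'a = real] by linarith
    then show "w \<in> {w. Re w > -1}" by simp
  qed
    have closedS: "closed S"
      unfolding S_def by (intro closed_Collect_conj closed_Collect_le continuous_intros)
    have boundS: "norm w \<le> n + 3 / 2" if "w \<in> S" for w
      
    proof -
      have "\<bar>Re w - n\<bar> \<le> 1 / 2" "\<bar>Im w\<bar> \<le> 1" using that by (simp_all add: S_def)
      then show ?thesis using cmod_le[of w] by linarith
    qed
    have "norm (\<phi> z) \<le> 4 * (C * exp (\<tau> * (n + 3 / 2)))"
    proof (rule maximum_modulus_frontier[where f = \<phi> and S = S])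
      show "\<phi> holomorphic_on interior S"
        using \<phi> by (rule holomorphic_on_subset) (use S_sub interior_subset in blast)
      show "continuous_on (closure S) \<phi>"
        using \<phi> S_sub closedS by (auto intro: holomorphic_on_imp_continuous_on holomorphic_on_subset)
      show "bounded S" using boundS by (auto simp: bounded_iff)
      show "z \<in> S" using n False by (auto simp: S_def)
      fix w assume w: "w \<in> frontier S"
      then have wS: "w \<in> S" using closedS by (auto simp: frontier_def)
      have "norm (F w) \<le> C * exp (\<tau> * (n + 3 / 2)) * 1"
      proof -
        have "\<tau> * norm w \<le> \<tau> * (n + 3 / 2)" using boundS[OF wS] \<tau> by (rule mult_left_mono)
        then have "C * exp (\<tau> * norm w) \<le> C * exp (\<tau> * (n + 3 / 2))" using C by simp
        with growth[of w] show ?thesis by linarith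
      qed
      moreover have "\<bar>Re w - n\<bar> = 1 / 2 \<or> \<bar>Im w\<bar> = 1"
      proof (rule ccontr)
        assume "\<not> (\<bar>Re w - n\<bar> = 1 / 2 \<or> \<bar>Im w\<bar> = 1)"
        with wS have "w \<in> {w. \<bar>Re w - n\<bar> < 1 / 2} \<inter> {w. \<bar>Im w\<bar> < 1}"
          by (auto simp: S_def)
        moreover have "open ({w. \<bar>Re w - n\<bar> < 1 / 2} \<inter> {w. \<bar>Im w\<bar> < 1})"
          by (intro open_Int open_Collect_less continuous_intros)
        moreover have "{w. \<bar>Re w - n\<bar> < 1 / 2} \<inter> {w. \<bar>Im w\<bar> < 1} \<subseteq> S"
          by (auto simp: S_def)
        ultimately have "w \<in> interior S" by (meson interiorI)
        with w show False by (simp add: frontier_def)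
      qed
      then have "1 / 4 \<le> norm (sin (of_real pi * w))"
      proof
        assume "\<bar>Re w - n\<bar> = 1 / 2"
        then show ?thesis using norm_sin_pi_ge_1[of w n] by simp
      next
        assume "\<bar>Im w\<bar> = 1"
        then have "exp pi / 4 \<le> norm (sin (of_real pi * w))"
          using norm_sin_pi_ge_exp[of w] by simp
        moreover have "exp pi \<ge> 1" by simp
        ultimately show ?thesis by argo
      qed
      ultimately show "norm (\<phi> w) \<le> 4 * (C * exp (\<tau> * (n + 3 / 2)))"
        using wS S_sub by (intro le[where e = 1]) auto
    qed
    \<comment> \<open>From n \<le> Re z + 1/2 the exponent exceeds \<tau> Re z by at most 2 \<tau>,
      and as |Im z| < 1 the missing decay costs at most pi - \<kappa>. This is the origin of the
      constant in the statement.\<close>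
    also have "\<dots> \<le> 4 * (C * exp (2 * \<tau> + (pi - \<kappa>) + (\<tau> * Re z - (pi - \<kappa>) * \<bar>Im z\<bar>)))"
    proof -
      have "\<tau> * (n + 3 / 2) \<le> \<tau> * (2 + Re z)"
        using n \<tau> by (intro mult_left_mono) linarith+
      moreover have "(pi - \<kappa>) * \<bar>Im z\<bar> \<le> (pi - \<kappa>)"
        using False \<kappa> by (intro mult_left_le) auto
      ultimately show ?thesis using C by (simp add: algebra_simps)
    qed
    finally show ?thesis by (simp only: mult.assoc mult_exp_exp)
  qed
qed

text \<open>Division by the sine gains a factor of order exp (-pi |Im z|), so the quotient decays
  vertically at rate \<delta> = pi - \<kappa> > 0. This decay is traded for decay exp (-\<omega> Re
  z) of arbitrarily large rate with a constant independent of \<omega>, which forces the quotient to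
  vanish.\<close>

theorem carlson:
  fixes F :: "complex \<Rightarrow> complex"
  assumes hol: "F holomorphic_on UNIV" and \<kappa>: "\<kappa> < pi"
    and growth: "\<And>z. norm (F z) \<le> C * exp (\<tau> * norm z)"
    and axis: "\<And>y. norm (F (\<i> * of_real y)) \<le> C' * exp (\<kappa> * \<bar>y\<bar>)"
    and zeros: "\<And>n::nat. F (of_nat n) = 0"
  shows "F z = 0"
proof -
  define D where "D = \<bar>C\<bar> + \<bar>C'\<bar> + 1"
  have D: "D > 0" by (simp add: D_def)
  have gr: "norm (F z) \<le> D * exp (\<bar>\<tau>\<bar> * norm z)" for z
    by (rule order_trans[OF growth]) (auto simp: D_def intro!: mult_mono mult_right_mono)
  have ax: "norm (F (\<i> * of_real y)) \<le> D * exp (\<kappa> * \<bar>y\<bar>)" for y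
    by (rule order_trans[OF axis]) (auto simp: D_def intro!: mult_right_mono)
  obtain \<phi> where \<phi>: "\<phi> holomorphic_on {z. Re z > -1}"
    and quot: "\<And>z. Re z > -1 \<Longrightarrow> \<phi> z * sin (of_real pi * z) = F z"
    using divide_by_sin[OF hol zeros] by blast
  define K where "K = 4 * D * exp (2 * \<bar>\<tau>\<bar> + (pi - \<kappa>))"
  have K: "K > 0" using D by (simp add: K_def)
  define \<delta> where "\<delta> = pi - \<kappa>"
  have \<delta>: "\<delta> > 0" using \<kappa> by (simp add: \<delta>_def)
  have \<phi>_le: "norm (\<phi> z) \<le> K * exp (\<bar>\<tau>\<bar> * Re z - \<delta> * \<bar>Im z\<bar>)" if "Re z \<ge> 0" for z
    unfolding K_def \<delta>_def by (rule quotient_bound[OF hol D _ \<kappa> gr ax \<phi> quot that]) auto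
  have decay: "norm (\<phi> z) * exp (\<omega> * Re z) \<le> K" if z: "\<bar>Im z\<bar> < Re z" and \<omega>: "\<omega> \<ge> \<delta>" for z \<omega>
  proof -
    \<comment> \<open>On the boundary of the sector of slope \<open>t\<close>, the growth along the real axis (including the
      factor \<open>exp (\<omega> * z)\<close>) and the decay along the imaginary axis cancel, so the bound
      does not depend on \<open>\<omega>\<close>.\<close>
    define t where "t = (\<bar>\<tau>\<bar> + \<omega>) / \<delta>"
    \<comment> \<open>Slope at least 1 puts the region |Im z| < Re z, from which \<open>z\<close> is
      taken, inside the sector; this is the reason for requiring \<omega> \<ge> \<delta>.\<close>
    have t: "t \<ge> 1" using \<omega> \<delta> by (simp add: t_def)
    have Re_pos: "Re w \<ge> 0" if "\<bar>Im w\<bar> \<le> t * Re w" for w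
    proof -
      have "0 \<le> t * Re w" using that by linarith
      then show ?thesis using t by (simp add: zero_le_mult_iff)
    qed
    define f where "f = (\<lambda>w. \<phi> w * exp (of_real \<omega> * w))"
    have f_le: "norm (f w) \<le> K * exp ((\<bar>\<tau>\<bar> + \<omega>) * Re w - \<delta> * \<bar>Im w\<bar>)" if "Re w \<ge> 0" for w
    proof -
      have "norm (f w) \<le> K * exp (\<bar>\<tau>\<bar> * Re w - \<delta> * \<bar>Im w\<bar>) * exp (\<omega> * Re w)"
        using \<phi>_le[OF that] by (simp add: f_def norm_mult)
      then show ?thesis by (simp add: mult.assoc mult_exp_exp algebra_simps)
    qed
    have "norm (f z) \<le> K"
    proof (rule phragmen_lindelof_sector[where f = f and t = t and C = K and \<tau> = "\<bar>\<tau>\<bar> + \<omega>"])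
      show "f holomorphic_on {z. \<bar>Im z\<bar> \<le> t * Re z}"
        unfolding f_def
        by (intro holomorphic_intros holomorphic_on_subset[OF \<phi>]) (use Re_pos in fastforce)
      fix w
      show "norm (f w) \<le> K * exp ((\<bar>\<tau>\<bar> + \<omega>) * norm w)" if "w \<in> {z. \<bar>Im z\<bar> \<le> t * Re z}"
      proof -
        have "norm (f w) \<le> K * exp ((\<bar>\<tau>\<bar> + \<omega>) * Re w - \<delta> * \<bar>Im w\<bar>)"
          using f_le Re_pos that by blast
        also have "(\<bar>\<tau>\<bar> + \<omega>) * Re w - \<delta> * \<bar>Im w\<bar> \<le> (\<bar>\<tau>\<bar> + \<omega>) * norm w"
          using mult_left_mono[OF complex_Re_le_cmod[of w], of "\<bar>\<tau>\<bar> + \<omega>"] \<delta> \<omega>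
          by (smt (verit) mult_nonneg_nonneg abs_ge_zero)
        finally show ?thesis using K by simp
      qed
      show "norm (f w) \<le> K" if "\<bar>Im w\<bar> = t * Re w"
        using f_le[of w] Re_pos[of w] that \<delta> by (simp add: t_def)
      have "1 * Re z \<le> t * Re z" using t z by (intro mult_right_mono) auto
      then show "z \<in> {z. \<bar>Im z\<bar> \<le> t * Re z}" using z by simp
    qed (use t K in auto)
    then show ?thesis by (simp add: f_def norm_mult)
  qed
  have \<phi>0: "\<phi> z = 0" if z: "\<bar>Im z\<bar> < Re z" for z
  proof (rule ccontr)
    assume "\<phi> z \<noteq> 0"
    then have pos: "norm (\<phi> z) * Re z > 0" using z by simp
    \<comment> \<open>Large enough that exp x > x at x = \<omega> Re z already contradicts
      \<open>decay\<close>.\<close>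
    define \<omega> where "\<omega> = max \<delta> (K / (norm (\<phi> z) * Re z))"
    have "K \<le> norm (\<phi> z) * Re z * \<omega>"
    proof -
      have "K / (norm (\<phi> z) * Re z) \<le> \<omega>" by (simp add: \<omega>_def)
      then show ?thesis using pos by (simp only: pos_divide_le_eq mult.commute)
    qed
    also have "\<dots> = norm (\<phi> z) * (\<omega> * Re z)" by simp
    also have "\<dots> < norm (\<phi> z) * exp (\<omega> * Re z)"
      using \<open>\<phi> z \<noteq> 0\<close> exp_ge_add_one_self[of "\<omega> * Re z"]
      by (intro mult_strict_left_mono) (linarith, simp)
    also have "\<dots> \<le> K" by (rule decay[OF z]) (simp add: \<omega>_def)
    finally show False by simp
  qed
  show ?thesis
  proof (rule analytic_continuation_open[of "{z. \<bar>Im z\<bar> < Re z}" UNIV F "\<lambda>_. 0"])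
    show "open {z. \<bar>Im z\<bar> < Re z}" by (intro open_Collect_less continuous_intros)
    show "{z. \<bar>Im z\<bar> < Re z} \<noteq> {}" by (auto intro!: exI[of _ 1])
    show "F z = 0" if "z \<in> {z. \<bar>Im z\<bar> < Re z}" for z
      using \<phi>0[of z] quot[of z] that by auto
  qed (use hol in auto)
qed

section \<open>Taylor coefficients of inner functions\<close>

lemma borel_measurable_cis [measurable (raw)]:
  "f \<in> borel_measurable M \<Longrightarrow> (\<lambda>x. cis (f x)) \<in> borel_measurable M"
  by (rule measurable_compose[of f M borel]) (auto intro!: borel_measurable_continuous_onI continuous_intros)

lemma borel_measurable_cnj [measurable (raw)]:
  "f \<in> borel_measurable M \<Longrightarrow> (\<lambda>x. cnj (f x)) \<in> borel_measurable M"
  by (rule measurable_compose[of f M borel]) (auto intro!: borel_measurable_continuous_onI continuous_intros)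

lemma sums_integral_cis:
  fixes M :: "real measure" and f :: "real \<Rightarrow> complex" and \<theta> :: real
  assumes sets[measurable_cong]: "sets M = sets borel" and f: "integrable M f"
    and a: "summable (\<lambda>n. norm (a n :: complex))"
  shows "(\<lambda>n. a n * (LINT x|M. f x * cis (\<theta> * real n * x))) sums
           (LINT x|M. f x * (\<Sum>n. a n * cis (\<theta> * real n * x)))"
proof -
  have [measurable]: "f \<in> borel_measurable M" using f by auto
  have [measurable]: "(\<lambda>x. cis (c * x)) \<in> borel_measurable M" for c
    by measurable
  have fc: "integrable M (\<lambda>x. f x * cis (\<theta> * real n * x))" for n
    by (rule Bochner_Integration.integrable_bound[OF f]) (auto simp: norm_mult)
  have "(\<lambda>n. LINT x|M. a n * (f x * cis (\<theta> * real n * x))) sums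
           (LINT x|M. (\<Sum>n. a n * (f x * cis (\<theta> * real n * x))))"
  proof (rule sums_integral)
    show "integrable M (\<lambda>x. a n * (f x * cis (\<theta> * real n * x)))" for n
      using fc by simp
    show "AE x in M. summable (\<lambda>n. norm (a n * (f x * cis (\<theta> * real n * x))))"
      using a by (auto simp: norm_mult intro!: summable_mult2)
    show "summable (\<lambda>n. LINT x|M. norm (a n * (f x * cis (\<theta> * real n * x))))"
      using a by (simp add: norm_mult summable_mult2)
  qed
  moreover have "(\<Sum>n. a n * (f x * cis (\<theta> * real n * x))) = f x * (\<Sum>n. a n * cis (\<theta> * real n * x))" for x
  proof -
    have "summable (\<lambda>n. a n * cis (\<theta> * real n * x))"
      by (rule summable_norm_cancel) (use a in \<open>simp add: norm_mult\<close>)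
    from suminf_mult[OF this, of "f x"] show ?thesis by (simp add: mult_ac)
  qed
  ultimately show ?thesis by simp
qed

section \<open>Fourier coefficients of the squared modulus of an inner function\<close>

definition unit_lebesgue :: "real measure" where
  "unit_lebesgue = density lborel (\<lambda>x. ennreal (indicator {-1/2..1/2} x))"

lemma sets_unit_lebesgue [simp, measurable_cong]: "sets unit_lebesgue = sets borel"
  by (simp add: unit_lebesgue_def)

lemma prob_space_unit_lebesgue: "prob_space unit_lebesgue"
proof
  have "emeasure unit_lebesgue (space unit_lebesgue) = emeasure lborel {-1/2..1/2::real}"
    by (simp add: unit_lebesgue_def emeasure_density ennreal_indicator)
  then show "emeasure unit_lebesgue (space unit_lebesgue) = 1" by simp
qed

lemma AE_unit_lebesgueI:
  assumes "AE x in lborel. x \<in> {-1/2<..<1/2} \<longrightarrow> P x"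
  shows "AE x in unit_lebesgue. P x"
proof -
  have "AE x in lborel. x \<noteq> (1/2::real)" "AE x in lborel. x \<noteq> (-1/2::real)"
    by (rule AE_lborel_singleton)+
  with assms have "AE x in lborel. x \<in> {-1/2..1/2} \<longrightarrow> P x"
    by eventually_elim auto
  then show ?thesis
    unfolding unit_lebesgue_def by (subst AE_density) (auto split: split_indicator_asm)
qed

lemma integral_unit_lebesgue_cis:
  "(LINT x|unit_lebesgue. cis (2 * pi * of_int k * x)) = (if k = 0 then 1 else 0)"
proof (cases "k = 0")
  case True
  then show ?thesis
    using prob_space.prob_space[OF prob_space_unit_lebesgue] by simp
next
  case False
  define w where "w = 2 * pi * of_int k"
  have w: "w \<noteq> 0" using False by (simp add: w_def)
  define P where "P x = - \<i> * cis (w * x) / of_real w" for x :: real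
  have "(LINT x|unit_lebesgue. cis (w * x)) = (LINT x|lborel. indicator {-1/2..1/2} x *\<^sub>R cis (w * x))"
    unfolding unit_lebesgue_def
    by (subst integral_density) (auto intro!: borel_measurable_continuous_onI continuous_intros)
  also have "\<dots> = P (1/2) - P (-1/2)"
  proof (rule integral_FTC_Icc)
    fix x :: real
    have "(P has_vector_derivative (- \<i> * ((w * 1) *\<^sub>R (\<i> * cis (w * x))) / of_real w)) (at x within {-1/2..1/2})"
      unfolding P_def has_vector_derivative_def
      by (auto intro!: derivative_eq_intros simp: scaleR_conv_of_real algebra_simps)
    then show "(P has_vector_derivative cis (w * x)) (at x within {-1/2..1/2})"
      using w by (simp add: scaleR_conv_of_real)
  qed (auto intro!: continuous_intros)
  also have "P (1/2) = P (-1/2)"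
  proof -
    have "cis (w * (1/2)) = cis (w * (-1/2)) * cis (2 * pi * of_int k)"
      unfolding cis_mult by (simp add: w_def field_simps)
    then show ?thesis by (simp add: P_def)
  qed
  finally show ?thesis using False by (simp add: w_def)
qed

text \<open>The integral is a Fourier coefficient of |\<Phi>|^2. Termwise integration is used twice:
  to recover \<open>a\<close> from \<Phi>, and to expand one factor of |\<Phi>|^2. Absolute
  summability justifies both; it holds for the dilates b (r z) with r < 1.\<close>

lemma parseval_correlation:
  fixes a :: "nat \<Rightarrow> complex"
  assumes a: "summable (\<lambda>n. norm (a n))"
  defines "\<Phi> \<equiv> \<lambda>x. \<Sum>n. a n * cis (2 * pi * real n * x)"
  shows "(\<lambda>n. a n * cnj (a (n + k))) sums
           (LINT x|unit_lebesgue. of_real ((norm (\<Phi> x))\<^sup>2) * cis (2 * pi * real k * x))"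
proof -
  interpret prob_space unit_lebesgue by (rule prob_space_unit_lebesgue)
  have \<Phi>_le: "norm (\<Phi> x) \<le> (\<Sum>n. norm (a n))" for x
    unfolding \<Phi>_def using summable_norm[of "\<lambda>n. a n * cis (2 * pi * real n * x)"] a
    by (simp add: norm_mult)
  have \<Phi>_meas[measurable]: "\<Phi> \<in> borel_measurable unit_lebesgue"
    unfolding \<Phi>_def by measurable
  have coeff: "(LINT x|unit_lebesgue. cis (- 2 * pi * real m * x) * \<Phi> x) = a m" for m
  proof -
    have "(\<lambda>n. a n * (LINT x|unit_lebesgue. cis (- 2 * pi * real m * x) * cis (2 * pi * real n * x))) sums
        (LINT x|unit_lebesgue. cis (- 2 * pi * real m * x) * \<Phi> x)"
      unfolding \<Phi>_def
      by (rule sums_integral_cis[OF sets_unit_lebesgue _ a]) (auto intro!: integrable_const_bound[where B = 1])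
    moreover have "(LINT x|unit_lebesgue. cis (- 2 * pi * real m * x) * cis (2 * pi * real n * x)) =
        (if n = m then 1 else 0)" for n
      using integral_unit_lebesgue_cis[of "int n - int m"] by (simp add: cis_mult algebra_simps)
    ultimately have "(\<lambda>n. a n * (if n = m then 1 else 0)) sums
        (LINT x|unit_lebesgue. cis (- 2 * pi * real m * x) * \<Phi> x)" by simp
    moreover have "(\<lambda>n. a n * (if n = m then 1 else 0)) sums a m"
      using sums_single[of m a] by (simp add: if_distrib cong: if_cong)
    ultimately show ?thesis using sums_unique2 by blast
  qed
  have "(\<lambda>n. a n * (LINT x|unit_lebesgue. cnj (\<Phi> x) * cis (2 * pi * real k * x) * cis (2 * pi * real n * x))) sums
      (LINT x|unit_lebesgue. cnj (\<Phi> x) * cis (2 * pi * real k * x) * \<Phi> x)"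
  proof -
    have "integrable unit_lebesgue (\<lambda>x. cnj (\<Phi> x) * cis (2 * pi * real k * x))"
      by (rule integrable_const_bound[where B = "\<Sum>n. norm (a n)"]) (auto simp: norm_mult \<Phi>_le)
    from sums_integral_cis[OF sets_unit_lebesgue this a, of "2 * pi"] show ?thesis
      unfolding \<Phi>_def .
  qed
  moreover have "(LINT x|unit_lebesgue. cnj (\<Phi> x) * cis (2 * pi * real k * x) * cis (2 * pi * real n * x)) = cnj (a (n + k))" for n
  proof -
    have "(\<lambda>x. cnj (\<Phi> x) * cis (2 * pi * real k * x) * cis (2 * pi * real n * x)) =
        (\<lambda>x. cnj (cis (- 2 * pi * real (n + k) * x) * \<Phi> x))"
      by (auto simp: cis_mult cis_cnj algebra_simps)
    then show ?thesis using coeff[of "n + k"] by (simp only: Bochner_Integration.integral_cnj)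
  qed
  moreover have "cnj (\<Phi> x) * cis (2 * pi * real k * x) * \<Phi> x = of_real ((norm (\<Phi> x))\<^sup>2) * cis (2 * pi * real k * x)" for x
    by (simp add: complex_norm_square mult_ac del: of_real_power)
  ultimately show ?thesis by simp
qed

text \<open>As |b| = 1 almost everywhere on the circle, |b|^2 has the Fourier coefficients of the
  constant 1. The identity is taken for the dilates b (r z), and r tends to 1: by dominated
  convergence in the integral and by Tannery's theorem in the series. The majorant for the latter
  rests on square summability, which is obtained first from k = 0 through finite partial
  sums.\<close>

lemma inner_function_coeff_correlation:
  assumes "inner_function b"
  defines "B \<equiv> \<lambda>n. fps_nth (fps_expansion b 0) n"
  shows "summable (\<lambda>n. (norm (B n))\<^sup>2)"
    and "(\<lambda>n. B n * cnj (B (n + k))) sums (if k = 0 then 1 else 0)"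
proof -
  interpret prob_space unit_lebesgue by (rule prob_space_unit_lebesgue)
  have hol: "b holomorphic_on ball 0 1" and b_le: "\<And>z. norm z < 1 \<Longrightarrow> norm (b z) \<le> 1"
    and rad: "AE x in lborel. x \<in> {-1/2<..<1/2} \<longrightarrow>
        (\<exists>l. norm l = 1 \<and> ((\<lambda>r::real. b (of_real r * cis (2 * pi * x))) \<longlongrightarrow> l) (at_left 1))"
    using assms by (auto simp: inner_function_def)
  have b_sums: "(\<lambda>n. B n * z ^ n) sums b z" if "norm z < 1" for z
    using holomorphic_power_series[OF hol, of z] that by (simp add: B_def fps_expansion_def)
  have B_abs: "summable (\<lambda>n. norm (B n * of_real r ^ n))" if "0 \<le> r" "r < 1" for r :: real
  proof (rule powser_insidea)
    show "summable (\<lambda>n. B n * of_real ((r + 1) / 2) ^ n)"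
      using b_sums[of "of_real ((r + 1) / 2)"] that by (auto simp: sums_iff simp del: of_real_divide of_real_add)
    show "norm (of_real r :: complex) < norm (of_real ((r + 1) / 2) :: complex)"
      using that by (simp del: of_real_divide of_real_add)
  qed
  define r where "r i = 1 - inverse (real (Suc i))" for i
  have r: "0 \<le> r i" "r i < 1" for i
    by (auto simp: r_def field_simps)
  have r_lim: "r \<longlonglongrightarrow> 1"
    using tendsto_diff[OF tendsto_const LIMSEQ_inverse_real_of_nat, of "1::real"] by (simp add: r_def[abs_def])
  have r_left: "filterlim r (at_left 1) sequentially"
    unfolding filterlim_at by (auto simp: r_lim r less_imp_neq)
  define f :: "nat \<Rightarrow> real \<Rightarrow> complex" where "f i x = of_real ((norm (b (of_real (r i) * cis (2 * pi * x))))\<^sup>2)" for i x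
  have corr: "(\<lambda>n. B n * cnj (B (n + k)) * of_real (r i ^ (2 * n + k))) sums
      (LINT x|unit_lebesgue. f i x * cis (2 * pi * real k * x))" for i k
  proof -
    have "(\<Sum>n. B n * of_real (r i) ^ n * cis (2 * pi * real n * x)) = b (of_real (r i) * cis (2 * pi * x))" for x
    proof -
      have "norm (of_real (r i) * cis (2 * pi * x)) < 1" using r[of i] by (simp add: norm_mult)
      from sums_unique[OF b_sums[OF this]] show ?thesis
        by (simp add: power_mult_distrib Complex.DeMoivre mult.assoc mult.left_commute)
    qed
    then show ?thesis
      using parseval_correlation[OF B_abs[OF r[of i]], of k]
      by (simp add: f_def power_add power_mult_distrib mult_ac power_mult power2_eq_square)
  qed
  have lim: "(\<lambda>i. LINT x|unit_lebesgue. f i x * cis (2 * pi * real k * x)) \<longlonglongrightarrow> (if k = 0 then 1 else 0)" for k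
  proof -
    have "continuous_on UNIV (\<lambda>x. b (of_real (r i) * cis (2 * pi * x)))" for i
      by (rule continuous_on_compose2[OF holomorphic_on_imp_continuous_on[OF hol]])
         (use r in \<open>auto intro!: continuous_intros simp: norm_mult\<close>)
    then have [measurable]: "(\<lambda>x. b (of_real (r i) * cis (2 * pi * x))) \<in> borel_measurable unit_lebesgue" for i
      by (simp add: measurable_cong_sets[OF sets_unit_lebesgue refl] borel_measurable_continuous_onI)
    have "(\<lambda>i. LINT x|unit_lebesgue. f i x * cis (2 * pi * real k * x)) \<longlonglongrightarrow> (LINT x|unit_lebesgue. 1 * cis (2 * pi * real k * x))"
    proof (rule integral_dominated_convergence[where w = "\<lambda>_. 1"])
      have "norm (f i x) \<le> 1" for i x
        using b_le[of "of_real (r i) * cis (2 * pi * x)"] r[of i] by (simp add: f_def norm_mult norm_power power_le_one)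
      then show "AE x in unit_lebesgue. norm (f i x * cis (2 * pi * real k * x)) \<le> 1" for i
        by (simp add: norm_mult)
      show "AE x in unit_lebesgue. (\<lambda>i. f i x * cis (2 * pi * real k * x)) \<longlonglongrightarrow> 1 * cis (2 * pi * real k * x)"
        using AE_unit_lebesgueI[OF rad]
      proof eventually_elim
        case (elim x)
        then obtain l where l: "norm l = 1" "((\<lambda>r::real. b (of_real r * cis (2 * pi * x))) \<longlongrightarrow> l) (at_left 1)"
          by blast
        have "(\<lambda>i. b (of_real (r i) * cis (2 * pi * x))) \<longlonglongrightarrow> l"
          using filterlim_compose[OF l(2) r_left] by simp
        then have "(\<lambda>i. f i x * cis (2 * pi * real k * x)) \<longlonglongrightarrow> of_real ((norm l)\<^sup>2) * cis (2 * pi * real k * x)"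
          unfolding f_def by (intro tendsto_intros)
        then show ?case using l by simp
      qed
      show "(\<lambda>x. f i x * cis (2 * pi * real k * x)) \<in> borel_measurable unit_lebesgue" for i
        unfolding f_def by measurable
    qed auto
    then show ?thesis
      using integral_unit_lebesgue_cis[of "int k"] by simp
  qed
  show sq: "summable (\<lambda>n. (norm (B n))\<^sup>2)"
  proof (rule summableI_nonneg_bounded[where x = 1])
    fix N
    have "(\<Sum>n<N. (norm (B n))\<^sup>2 * r i ^ (2 * n)) \<le> norm (LINT x|unit_lebesgue. f i x * cis (2 * pi * real 0 * x))" for i
    proof -
      have eq: "B n * cnj (B (n + 0)) * of_real (r i ^ (2 * n + 0)) = of_real ((norm (B n))\<^sup>2 * r i ^ (2 * n))" for n
        by (simp add: complex_norm_square del: of_real_power)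
      from corr[of 0 i] have "(\<lambda>n. of_real ((norm (B n))\<^sup>2 * r i ^ (2 * n)) :: complex) sums
          (LINT x|unit_lebesgue. f i x * cis (2 * pi * real 0 * x))"
        unfolding eq .
      then have s: "(\<lambda>n. (norm (B n))\<^sup>2 * r i ^ (2 * n)) sums Re (LINT x|unit_lebesgue. f i x * cis (2 * pi * real 0 * x))"
        using sums_Re by fastforce
      have "(\<Sum>n<N. (norm (B n))\<^sup>2 * r i ^ (2 * n)) \<le> Re (LINT x|unit_lebesgue. f i x * cis (2 * pi * real 0 * x))"
        unfolding sums_unique[OF s] using r[of i] by (intro sum_le_suminf sums_summable[OF s]) auto
      then show ?thesis using complex_Re_le_cmod order_trans by blast
    qed
    moreover have "(\<lambda>i. \<Sum>n<N. (norm (B n))\<^sup>2 * r i ^ (2 * n)) \<longlonglongrightarrow> (\<Sum>n<N. (norm (B n))\<^sup>2 * 1 ^ (2 * n))"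
      by (intro tendsto_intros r_lim)
    moreover have "(\<lambda>i. norm (LINT x|unit_lebesgue. f i x * cis (2 * pi * real 0 * x))) \<longlonglongrightarrow> norm (1::complex)"
      using lim[of 0] by (intro tendsto_norm) simp
    ultimately have "(\<Sum>n<N. (norm (B n))\<^sup>2 * 1 ^ (2 * n)) \<le> norm (1::complex)"
      by (intro LIMSEQ_le[of _ _ _ "norm (1::complex)"]) auto
    then show "(\<Sum>n<N. (norm (B n))\<^sup>2) \<le> 1" by simp
  qed auto
  show "(\<lambda>n. B n * cnj (B (n + k))) sums (if k = 0 then 1 else 0)"
  proof -
    \<comment> \<open>A majorant independent of the radius, from |x y| \<le> |x|^2 + |y|^2.\<close>
    define Q where "Q n = (norm (B n))\<^sup>2 + (norm (B (n + k)))\<^sup>2" for n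
    have Q: "norm (B n * cnj (B (n + k))) \<le> Q n" for n
      using sum_squares_bound[of "norm (B n)" "norm (B (n + k))"]
        mult_nonneg_nonneg[OF norm_ge_zero[of "B n"] norm_ge_zero[of "B (n + k)"]]
      unfolding Q_def norm_mult complex_mod_cnj by linarith
    have sumQ: "summable Q"
      unfolding Q_def using sq by (intro summable_add summable_ignore_initial_segment) auto
    have "(\<lambda>i. \<Sum>n. B n * cnj (B (n + k)) * of_real (r i ^ (2 * n + k))) \<longlonglongrightarrow> (\<Sum>n. B n * cnj (B (n + k)))"
    proof (rule tannerys_theorem[THEN conjunct2, THEN conjunct2])
      show "(\<lambda>i. B n * cnj (B (n + k)) * of_real (r i ^ (2 * n + k))) \<longlonglongrightarrow> B n * cnj (B (n + k))" for n
      proof -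
        have "(\<lambda>i. B n * cnj (B (n + k)) * of_real (r i ^ (2 * n + k))) \<longlonglongrightarrow> B n * cnj (B (n + k)) * of_real (1 ^ (2 * n + k))"
          by (intro tendsto_intros r_lim)
        then show ?thesis by simp
      qed
      have "norm (B n * cnj (B (n + k)) * of_real (r i ^ (2 * n + k))) \<le> Q n" for n i
        using mult_mono[OF Q[of n] power_le_one[of "r i" "2 * n + k"]] r[of i]
        by (simp add: norm_mult norm_power Q_def)
      then show "\<forall>\<^sub>F (n, i) in sequentially \<times>\<^sub>F sequentially. norm (B n * cnj (B (n + k)) * of_real (r i ^ (2 * n + k))) \<le> Q n"
        by (intro always_eventually) auto
    qed (use sumQ in auto)
    moreover have "(\<Sum>n. B n * cnj (B (n + k)) * of_real (r i ^ (2 * n + k))) = (LINT x|unit_lebesgue. f i x * cis (2 * pi * real k * x))" for i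
      using corr[of k i] by (simp add: sums_iff)
    ultimately have "(\<Sum>n. B n * cnj (B (n + k))) = (if k = 0 then 1 else 0)"
      using lim[of k] LIMSEQ_unique by force
    moreover have "summable (\<lambda>n. B n * cnj (B (n + k)))"
      by (rule summable_comparison_test'[OF sumQ]) (use Q in auto)
    ultimately show ?thesis by (simp add: sums_iff)
  qed
qed

section \<open>Square-integrable functions\<close>

definition L2_inner :: "'a measure \<Rightarrow> ('a \<Rightarrow> complex) \<Rightarrow> ('a \<Rightarrow> complex) \<Rightarrow> complex" where
  "L2_inner M f g = (LINT x|M. f x * cnj (g x))"

definition L2_sqnorm :: "'a measure \<Rightarrow> ('a \<Rightarrow> complex) \<Rightarrow> real" where
  "L2_sqnorm M f = (LINT x|M. (norm (f x))\<^sup>2)"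

lemma in_L2_integrable_norm2: "in_L2 M f \<Longrightarrow> integrable M (\<lambda>x. (norm (f x))\<^sup>2)"
  by (auto simp: in_L2_def)

lemma integrable_L2_inner:
  assumes "in_L2 M f" "in_L2 M g"
  shows "integrable M (\<lambda>x. f x * cnj (g x))"
proof (rule Bochner_Integration.integrable_bound)
  show "integrable M (\<lambda>x. (norm (f x))\<^sup>2 + (norm (g x))\<^sup>2)"
    using assms by (auto simp: in_L2_def)
  show "(\<lambda>x. f x * cnj (g x)) \<in> borel_measurable M"
    using assms by (auto simp: in_L2_def)
  have "norm (f x * cnj (g x)) \<le> norm ((norm (f x))\<^sup>2 + (norm (g x))\<^sup>2)" for x
    using sum_squares_bound[of "norm (f x)" "norm (g x)"]
      mult_nonneg_nonneg[OF norm_ge_zero[of "f x"] norm_ge_zero[of "g x"]]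
    unfolding norm_mult complex_mod_cnj real_norm_def by linarith
  then show "AE x in M. norm (f x * cnj (g x)) \<le> norm ((norm (f x))\<^sup>2 + (norm (g x))\<^sup>2)"
    by simp
qed

lemma in_L2_cmult [intro]: "in_L2 M f \<Longrightarrow> in_L2 M (\<lambda>x. c * f x)"
  by (auto simp: in_L2_def norm_mult power_mult_distrib)

lemma in_L2_add [intro]:
  assumes "in_L2 M f" "in_L2 M g"
  shows "in_L2 M (\<lambda>x. f x + g x)"
  unfolding in_L2_def
proof (rule conjI[OF _ Bochner_Integration.integrable_bound])
  show "integrable M (\<lambda>x. 2 * (norm (f x))\<^sup>2 + 2 * (norm (g x))\<^sup>2)"
    using assms by (auto simp: in_L2_def)
  have "(norm (f x + g x))\<^sup>2 \<le> 2 * (norm (f x))\<^sup>2 + 2 * (norm (g x))\<^sup>2" for x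
  proof -
    have "(norm (f x + g x))\<^sup>2 \<le> (norm (f x) + norm (g x))\<^sup>2"
      by (intro power_mono norm_triangle_ineq) auto
    also have "\<dots> \<le> 2 * (norm (f x))\<^sup>2 + 2 * (norm (g x))\<^sup>2"
      using sum_squares_bound[of "norm (f x)" "norm (g x)"] by (simp add: power2_sum)
    finally show ?thesis .
  qed
  then show "AE x in M. norm ((norm (f x + g x))\<^sup>2) \<le> norm (2 * (norm (f x))\<^sup>2 + 2 * (norm (g x))\<^sup>2)"
    by simp
qed (use assms in \<open>auto simp: in_L2_def\<close>)

lemma in_L2_diff [intro]: "in_L2 M f \<Longrightarrow> in_L2 M g \<Longrightarrow> in_L2 M (\<lambda>x. f x - g x)"
  using in_L2_add[OF _ in_L2_cmult[of M g "-1"], of f] by simp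

lemma in_L2_zero [intro]: "in_L2 M (\<lambda>x. 0)"
  by (simp add: in_L2_def)

lemma in_L2_sum [intro]: "(\<And>i. i \<in> I \<Longrightarrow> in_L2 M (f i)) \<Longrightarrow> in_L2 M (\<lambda>x. \<Sum>i\<in>I. f i x)"
  by (induction I rule: infinite_finite_induct) auto

lemma L2_inner_commute: "L2_inner M g f = cnj (L2_inner M f g)"
  unfolding L2_inner_def by (subst Bochner_Integration.integral_cnj[symmetric]) (simp add: mult.commute)

lemma L2_inner_self: "L2_inner M f f = of_real (L2_sqnorm M f)"
proof -
  have "(\<lambda>x. f x * cnj (f x)) = (\<lambda>x. of_real ((norm (f x))\<^sup>2))"
    by (auto simp: complex_norm_square simp del: of_real_power)
  then show ?thesis
    unfolding L2_inner_def L2_sqnorm_def by (simp only: integral_complex_of_real)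
qed

lemma L2_inner_diff_left:
  assumes "in_L2 M f" "in_L2 M g" "in_L2 M h"
  shows "L2_inner M (\<lambda>x. f x - g x) h = L2_inner M f h - L2_inner M g h"
  using assms unfolding L2_inner_def
  by (simp add: left_diff_distrib Bochner_Integration.integral_diff integrable_L2_inner)

lemma L2_inner_cmult_left: "L2_inner M (\<lambda>x. c * f x) h = c * L2_inner M f h"
  unfolding L2_inner_def by (simp add: mult.assoc)

lemma L2_inner_sum_left:
  assumes "\<And>i. i \<in> I \<Longrightarrow> in_L2 M (f i)" "in_L2 M h"
  shows "L2_inner M (\<lambda>x. \<Sum>i\<in>I. f i x) h = (\<Sum>i\<in>I. L2_inner M (f i) h)"
  using assms unfolding L2_inner_def
  by (simp add: sum_distrib_right Bochner_Integration.integral_sum integrable_L2_inner)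

lemma L2_inner_sum_right:
  assumes "\<And>i. i \<in> I \<Longrightarrow> in_L2 M (f i)" "in_L2 M h"
  shows "L2_inner M h (\<lambda>x. \<Sum>i\<in>I. c i * f i x) = (\<Sum>i\<in>I. cnj (c i) * L2_inner M h (f i))"
proof -
  have "L2_inner M (\<lambda>x. \<Sum>i\<in>I. c i * f i x) h = (\<Sum>i\<in>I. c i * L2_inner M (f i) h)"
    using assms by (subst L2_inner_sum_left) (auto simp: L2_inner_cmult_left)
  then show ?thesis
    by (subst L2_inner_commute) (simp add: L2_inner_commute[of M _ h])
qed

lemma L2_sqnorm_nonneg [simp]: "L2_sqnorm M f \<ge> 0"
  unfolding L2_sqnorm_def by simp

lemma L2_sqnorm_diff_cmult:
  assumes f: "in_L2 M f" and g: "in_L2 M g"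
  shows "L2_sqnorm M (\<lambda>x. f x - c * g x) = L2_sqnorm M f - 2 * Re (cnj c * L2_inner M f g) + (norm c)\<^sup>2 * L2_sqnorm M g"
proof -
  define h where "h = (\<lambda>x. f x - c * g x)"
  have cg: "in_L2 M (\<lambda>x. c * g x)" and h: "in_L2 M h"
    unfolding h_def by (rule in_L2_cmult[OF g], rule in_L2_diff[OF f in_L2_cmult[OF g]])
  have r: "L2_inner M u h = L2_inner M u f - cnj c * L2_inner M u g" if "in_L2 M u" for u
  proof -
    have "L2_inner M h u = L2_inner M f u - c * L2_inner M g u"
      unfolding h_def by (simp add: L2_inner_diff_left[OF f cg that] L2_inner_cmult_left)
    then show ?thesis
      by (subst L2_inner_commute) (simp add: L2_inner_commute[of M _ u])
  qed
  have "L2_inner M h h = L2_inner M f h - c * L2_inner M g h"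
    unfolding h_def using L2_inner_diff_left[OF f cg h] by (simp add: L2_inner_cmult_left h_def)
  also have "\<dots> = of_real (L2_sqnorm M f) - cnj c * L2_inner M f g - cnj (cnj c * L2_inner M f g) + c * cnj c * of_real (L2_sqnorm M g)"
    unfolding r[OF f] r[OF g] L2_inner_self L2_inner_commute[of M g f] by (simp add: algebra_simps)
  finally have "of_real (L2_sqnorm M h) = of_real (L2_sqnorm M f) - cnj c * L2_inner M f g - cnj (cnj c * L2_inner M f g) + of_real ((norm c)\<^sup>2) * of_real (L2_sqnorm M g)"
    unfolding L2_inner_self complex_norm_square .
  from arg_cong[OF this, of Re] show ?thesis
    unfolding h_def by (simp del: of_real_power)
qed

text \<open>Expand the nonnegative squared norm of f - t <f, g> g for real t, then choose t.\<close>

lemma L2_Cauchy_Schwarz: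
  assumes f: "in_L2 M f" and g: "in_L2 M g"
  shows "(norm (L2_inner M f g))\<^sup>2 \<le> L2_sqnorm M f * L2_sqnorm M g"
proof -
  define I where "I = (norm (L2_inner M f g))\<^sup>2"
  have I: "0 \<le> L2_sqnorm M f - 2 * t * I + t\<^sup>2 * I * L2_sqnorm M g" for t :: real
  proof -
    define c where "c = of_real t * L2_inner M f g"
    have "cnj c * L2_inner M f g = of_real (t * I)"
      by (simp add: c_def I_def complex_norm_square mult_ac del: of_real_power)
    then have "Re (cnj c * L2_inner M f g) = t * I" by simp
    moreover have "(norm c)\<^sup>2 = t\<^sup>2 * I" by (simp add: c_def I_def norm_mult power_mult_distrib)
    ultimately show ?thesis
      using L2_sqnorm_nonneg[of M "\<lambda>x. f x - c * g x"] L2_sqnorm_diff_cmult[OF f g, of c] by simp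
  qed
  have I0: "I \<ge> 0" by (simp add: I_def)
  show ?thesis
  proof (cases "L2_sqnorm M g = 0")
    case True
    have "I = 0"
    proof (rule ccontr)
      assume "I \<noteq> 0"
      \<comment> \<open>Here the inequality is linear in \<open>t\<close>, and this \<open>t\<close>
        turns it into 0 \<le> -1.\<close>
      then show False using I[of "(L2_sqnorm M f + 1) / (2 * I)"] True by simp
    qed
    then show ?thesis using True by (simp add: I_def)
  next
    case False
    then have G: "L2_sqnorm M g > 0" using L2_sqnorm_nonneg[of M g] by linarith
    have "(1 / L2_sqnorm M g)\<^sup>2 * I * L2_sqnorm M g = I / L2_sqnorm M g"
      using G by (simp add: power2_eq_square)
    with I[of "1 / L2_sqnorm M g"] have "I / L2_sqnorm M g \<le> L2_sqnorm M f" by simp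
    then show ?thesis using G by (simp add: I_def pos_divide_le_eq)
  qed
qed

text \<open>Riesz-Fischer. On a probability space the L^2 seminorm dominates the L^1 one, so a
  subsequence converges almost everywhere; Fatou's lemma along it bounds the distance from each
  \<open>f n\<close> to the limit.\<close>

lemma L2_complete:
  fixes f :: "nat \<Rightarrow> 'a \<Rightarrow> complex"
  assumes "prob_space M" and f: "\<And>n. in_L2 M (f n)"
    and cauchy: "\<And>e. e > 0 \<Longrightarrow> \<exists>N. \<forall>i\<ge>N. \<forall>j\<ge>N. L2_sqnorm M (\<lambda>x. f i x - f j x) < e"
  obtains g where "in_L2 M g" "(\<lambda>n. L2_sqnorm M (\<lambda>x. f n x - g x)) \<longlonglongrightarrow> 0"
proof -
  interpret prob_space M by fact
  have one: "in_L2 M (\<lambda>_. 1)" by (simp add: in_L2_def)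
  have int: "integrable M h" if "in_L2 M h" for h
    using integrable_L2_inner[OF that one] by simp
  have [measurable]: "f n \<in> borel_measurable M" for n using f by (simp add: in_L2_def)
  obtain r where r: "strict_mono r" and C: "AE x in M. Cauchy (\<lambda>i. f (r i) x)"
  proof (rule cauchy_L1_AE_cauchy_subseq[where M = M and s = f])
    show "integrable M (f n)" for n using int f by blast
    fix e :: real assume e: "e > 0"
    obtain N where N: "\<And>i j. i \<ge> N \<Longrightarrow> j \<ge> N \<Longrightarrow> L2_sqnorm M (\<lambda>x. f i x - f j x) < e\<^sup>2"
      using cauchy[of "e\<^sup>2"] e by auto
    have "(LINT x|M. norm (f i x - f j x)) < e" if "i \<ge> N" "j \<ge> N" for i j
    proof -
      define h where "h x = complex_of_real (norm (f i x - f j x))" for x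
      have h: "in_L2 M h"
        using in_L2_diff[OF f[of i] f[of j]] unfolding in_L2_def h_def by simp
      have "L2_inner M h (\<lambda>_. 1) = of_real (LINT x|M. norm (f i x - f j x))"
        by (simp add: L2_inner_def h_def)
      then have "(LINT x|M. norm (f i x - f j x))\<^sup>2 = (norm (L2_inner M h (\<lambda>_. 1)))\<^sup>2"
        by (simp add: norm_of_real)
      also have "\<dots> \<le> L2_sqnorm M h * L2_sqnorm M (\<lambda>_. 1)"
        by (rule L2_Cauchy_Schwarz[OF h one])
      also have "\<dots> = L2_sqnorm M (\<lambda>x. f i x - f j x)"
        by (simp add: L2_sqnorm_def h_def prob_space)
      also have "\<dots> < e\<^sup>2" by (rule N[OF that])
      finally show ?thesis using e by (simp add: power2_less_imp_less)
    qed
    then show "\<exists>N. \<forall>i\<ge>N. \<forall>j\<ge>N. (LINT x|M. norm (f i x - f j x)) < e" by blast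
  qed
  define g where "g x = lim (\<lambda>i. f (r i) x)" for x
  have [measurable]: "g \<in> borel_measurable M"
    unfolding g_def by measurable
  have lim: "AE x in M. (\<lambda>i. f (r i) x) \<longlonglongrightarrow> g x"
    using C by eventually_elim (simp add: g_def Cauchy_convergent convergent_LIMSEQ_iff[symmetric])
  \<comment> \<open>The nonnegative integral is used because integrability is only deduced from this
    bound.\<close>
  have fatou: "(\<integral>\<^sup>+x. ennreal ((norm (f n x - g x))\<^sup>2) \<partial>M) \<le> ennreal e"
    if N: "\<And>j. j \<ge> N \<Longrightarrow> L2_sqnorm M (\<lambda>x. f n x - f j x) \<le> e" for n N e
  proof -
    have "(\<integral>\<^sup>+x. ennreal ((norm (f n x - g x))\<^sup>2) \<partial>M) = (\<integral>\<^sup>+x. liminf (\<lambda>i. ennreal ((norm (f n x - f (r i) x))\<^sup>2)) \<partial>M)"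
    proof (rule nn_integral_cong_AE, use lim in eventually_elim)
      case (elim x)
      then have "(\<lambda>i. ennreal ((norm (f n x - f (r i) x))\<^sup>2)) \<longlonglongrightarrow> ennreal ((norm (f n x - g x))\<^sup>2)"
        by (intro tendsto_ennrealI tendsto_intros)
      then show ?case by (intro lim_imp_Liminf[symmetric]) auto
    qed
    also have "\<dots> \<le> liminf (\<lambda>i. \<integral>\<^sup>+x. ennreal ((norm (f n x - f (r i) x))\<^sup>2) \<partial>M)"
      by (rule nn_integral_liminf) measurable
    also have "\<dots> = liminf (\<lambda>i. ennreal (L2_sqnorm M (\<lambda>x. f n x - f (r i) x)))"
    proof -
      have "(\<integral>\<^sup>+x. ennreal ((norm (f n x - f (r i) x))\<^sup>2) \<partial>M) = ennreal (L2_sqnorm M (\<lambda>x. f n x - f (r i) x))" for i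
        unfolding L2_sqnorm_def
        by (rule nn_integral_eq_integral[OF in_L2_integrable_norm2[OF in_L2_diff[OF f f]]]) simp
      then show ?thesis by simp
    qed
    also have "\<dots> \<le> liminf (\<lambda>i. ennreal e)"
    proof (rule Liminf_mono)
      have "\<forall>\<^sub>F i in sequentially. i \<ge> N" by (rule eventually_ge_at_top)
      then show "\<forall>\<^sub>F i in sequentially. ennreal (L2_sqnorm M (\<lambda>x. f n x - f (r i) x)) \<le> ennreal e"
      proof eventually_elim
        case (elim i)
        then have "r i \<ge> N" using seq_suble[OF r, of i] by linarith
        then show ?case using N by (simp add: ennreal_leI)
      qed
    qed
    also have "\<dots> = ennreal e" by (simp add: Liminf_const)
    finally show ?thesis .
  qed
  have diff: "in_L2 M (\<lambda>x. f n x - g x) \<and> L2_sqnorm M (\<lambda>x. f n x - g x) \<le> e"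
    if N: "\<And>j. j \<ge> N \<Longrightarrow> L2_sqnorm M (\<lambda>x. f n x - f j x) \<le> e" for n N e
  proof -
    have e: "e \<ge> 0" using N[of N] L2_sqnorm_nonneg order_trans by blast
    have "integrable M (\<lambda>x. (norm (f n x - g x))\<^sup>2)"
      using le_less_trans[OF fatou[OF N]] by (intro integrableI_bounded) (auto simp: ennreal_less_top)
    moreover from this have "ennreal (L2_sqnorm M (\<lambda>x. f n x - g x)) \<le> ennreal e"
      using fatou[OF N] unfolding L2_sqnorm_def by (subst nn_integral_eq_integral[symmetric]) auto
    ultimately show ?thesis using e by (auto simp: in_L2_def)
  qed
  obtain N where "\<forall>i\<ge>N. \<forall>j\<ge>N. L2_sqnorm M (\<lambda>x. f i x - f j x) < 1"
    using cauchy[of 1] by auto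
  then have "in_L2 M (\<lambda>x. f N x - g x)"
    using diff[of N N 1] by (simp add: less_imp_le)
  from in_L2_diff[OF f[of N] this] have g: "in_L2 M g" by simp
  moreover have "(\<lambda>n. L2_sqnorm M (\<lambda>x. f n x - g x)) \<longlonglongrightarrow> 0"
  proof (rule LIMSEQ_I)
    fix e :: real assume e: "e > 0"
    obtain N where N: "\<forall>i\<ge>N. \<forall>j\<ge>N. L2_sqnorm M (\<lambda>x. f i x - f j x) < e / 2"
      using cauchy[of "e / 2"] e by auto
    have "norm (L2_sqnorm M (\<lambda>x. f n x - g x) - 0) < e" if "n \<ge> N" for n
    proof -
      have "L2_sqnorm M (\<lambda>x. f n x - g x) \<le> e / 2"
        using diff[of N n "e / 2"] N that by (simp add: less_imp_le)
      with e L2_sqnorm_nonneg[of M "\<lambda>x. f n x - g x"] show ?thesis by simp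
    qed
    then show "\<exists>N. \<forall>n\<ge>N. norm (L2_sqnorm M (\<lambda>x. f n x - g x) - 0) < e" by blast
  qed
  ultimately show ?thesis by (rule that)
qed

section \<open>The Kaczmarz algorithm and the model space\<close>

lemma tendsto_zero_approx:
  fixes X :: "nat \<Rightarrow> complex"
  assumes "\<And>e. e > 0 \<Longrightarrow> \<exists>Y. Y \<longlonglongrightarrow> 0 \<and> (\<forall>\<^sub>F K in sequentially. norm (X K - Y K) \<le> e)"
  shows "X \<longlonglongrightarrow> 0"
proof (rule tendstoI)
  fix e :: real assume e: "e > 0"
  obtain Y where Y: "Y \<longlonglongrightarrow> 0" "\<forall>\<^sub>F K in sequentially. norm (X K - Y K) \<le> e / 2"
    using assms[of "e / 2"] e by auto
  have "\<forall>\<^sub>F K in sequentially. dist (Y K) 0 < e / 2"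
    using tendstoD[OF Y(1), of "e / 2"] e by simp
  with Y(2) show "\<forall>\<^sub>F K in sequentially. dist (X K) 0 < e"
  proof eventually_elim
    case (elim K)
    then show ?case using norm_triangle_sub[of "X K" "Y K"] by simp
  qed
qed

lemma Cauchy_Schwarz_sum_complex:
  fixes x y :: "'a \<Rightarrow> complex"
  shows "(norm (\<Sum>i\<in>I. x i * cnj (y i)))\<^sup>2 \<le> (\<Sum>i\<in>I. (norm (x i))\<^sup>2) * (\<Sum>i\<in>I. (norm (y i))\<^sup>2)"
proof -
  have "norm (\<Sum>i\<in>I. x i * cnj (y i)) \<le> (\<Sum>i\<in>I. norm (x i) * norm (y i))"
    by (rule order_trans[OF norm_sum]) (simp add: norm_mult)
  then have "(norm (\<Sum>i\<in>I. x i * cnj (y i)))\<^sup>2 \<le> (\<Sum>i\<in>I. norm (x i) * norm (y i))\<^sup>2"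
    by (intro power_mono) auto
  also have "\<dots> \<le> (\<Sum>i\<in>I. (norm (x i))\<^sup>2) * (\<Sum>i\<in>I. (norm (y i))\<^sup>2)"
    by (rule Cauchy_Schwarz_ineq_sum)
  finally show ?thesis .
qed

lemma summable_tail_small:
  fixes f :: "nat \<Rightarrow> real"
  assumes "summable f" "\<And>n. f n \<ge> 0" "e > 0"
  obtains N where "\<And>m n. m \<ge> N \<Longrightarrow> sum f {m..<n} < e"
proof -
  obtain N where N: "\<forall>m\<ge>N. \<forall>n. norm (sum f {m..<n}) < e"
    using assms(1,3) unfolding summable_Cauchy by blast
  have "sum f {m..<n} < e" if "m \<ge> N" for m n
    using N that by (metis abs_ge_self order_le_less_trans real_norm_def)
  then show ?thesis by (rule that)
qed

section \<open>Shifts of an inner power series\<close>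

text \<open>The case k = 0 says that b has norm 1 in H^2; the other cases say that z^m b and z^n b
  are orthogonal for distinct m and n.\<close>

locale inner_coeffs =
  fixes B :: "complex fps"
  assumes correlation: "(\<lambda>n. fps_nth B n * cnj (fps_nth B (n + k))) sums (if k = 0 then 1 else 0)"
begin

definition shifted :: "nat \<Rightarrow> nat \<Rightarrow> complex" where
  "shifted j k = fps_nth (fps_X ^ j * B) k"

lemma shifted_eq: "shifted j k = (if k < j then 0 else fps_nth B (k - j))"
  by (simp add: shifted_def fps_X_power_mult_nth)

text \<open>Since \<open>shifted j\<close> starts at index j, only coefficients of \<open>H\<close>
  up to k matter, so \<open>J\<close> may be any finite set that catches the nonzero ones among
  them.\<close>

lemma mult_nth_shifted:
  assumes "finite J" "\<And>j. j \<le> k \<Longrightarrow> j \<notin> J \<Longrightarrow> fps_nth H j = 0"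
  shows "fps_nth (B * H) k = (\<Sum>j\<in>J. fps_nth H j * shifted j k)"
proof -
  have "fps_nth (B * H) k = (\<Sum>j\<in>{0..k}. fps_nth H j * shifted j k)"
    by (subst mult.commute) (auto simp: fps_mult_nth shifted_eq intro!: sum.cong)
  also have "\<dots> = (\<Sum>j\<in>{0..k} \<inter> J. fps_nth H j * shifted j k)"
    using assms by (intro sum.mono_neutral_right) auto
  also have "\<dots> = (\<Sum>j\<in>J. fps_nth H j * shifted j k)"
    using assms by (intro sum.mono_neutral_left) (auto simp: shifted_eq)
  finally show ?thesis .
qed

lemma shifted_orthonormal: "(\<lambda>k. shifted n k * cnj (shifted j k)) sums (if n = j then 1 else 0)"
proof -
  have *: "(\<lambda>k. shifted j k * cnj (shifted n k)) sums (if n = j then 1 else 0)" if "n \<le> j" for n j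
  proof -
    have "(\<lambda>i. shifted j (i + j) * cnj (shifted n (i + j))) = (\<lambda>i. fps_nth B i * cnj (fps_nth B (i + (j - n))))"
      using that by (auto simp: shifted_eq)
    then have "(\<lambda>i. shifted j (i + j) * cnj (shifted n (i + j))) sums (if n = j then 1 else 0)"
      using correlation[of "j - n"] that by (cases "n = j") simp_all
    then show ?thesis
      by (subst (asm) sums_zero_iff_shift) (auto simp: shifted_eq)
  qed
  show ?thesis
  proof (cases "n \<le> j")
    case True
    have "(\<lambda>k. cnj (shifted j k * cnj (shifted n k))) sums cnj (if n = j then 1 else 0)"
      using *[OF True] by (simp only: sums_cnj)
    then show ?thesis by (simp add: mult.commute if_distrib[of cnj] cong: if_cong)
  next
    case False
    then show ?thesis using *[of j n] by simp
  qed
qed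

text \<open>By orthonormality the full series equals the right-hand side: multiplication by b is
  isometric on polynomials.\<close>

lemma sum_norm2_shifted_combination_le:
  assumes "finite J"
  shows "(\<Sum>k<K. (norm (\<Sum>j\<in>J. h j * shifted j k))\<^sup>2) \<le> (\<Sum>j\<in>J. (norm (h j))\<^sup>2)"
proof -
  define s where "s k = (\<Sum>j\<in>J. h j * shifted j k)" for k
  have "(\<lambda>k. \<Sum>i\<in>J. \<Sum>j\<in>J. h i * cnj (h j) * (shifted i k * cnj (shifted j k))) sums
      (\<Sum>i\<in>J. \<Sum>j\<in>J. h i * cnj (h j) * (if i = j then 1 else 0))"
    by (intro sums_sum sums_mult shifted_orthonormal)
  moreover have "(\<Sum>i\<in>J. \<Sum>j\<in>J. h i * cnj (h j) * (shifted i k * cnj (shifted j k))) = of_real ((norm (s k))\<^sup>2)" for k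
    unfolding complex_norm_square s_def cnj_sum sum_product by (simp add: mult_ac)
  moreover have "(\<Sum>i\<in>J. \<Sum>j\<in>J. h i * cnj (h j) * (if i = j then 1 else 0)) = of_real (\<Sum>j\<in>J. (norm (h j))\<^sup>2)"
    using assms by (simp add: if_distrib complex_norm_square cong: if_cong del: of_real_power)
  ultimately have "(\<lambda>k. of_real ((norm (s k))\<^sup>2) :: complex) sums of_real (\<Sum>j\<in>J. (norm (h j))\<^sup>2)"
    by simp
  then have s: "(\<lambda>k. (norm (s k))\<^sup>2) sums (\<Sum>j\<in>J. (norm (h j))\<^sup>2)"
    by (simp only: sums_of_real_iff)
  show ?thesis
    unfolding sums_unique[OF s] s_def[symmetric] by (intro sum_le_suminf sums_summable[OF s]) auto
qed

lemma sum_norm2_shifted_le_1: "(\<Sum>k<K. (norm (shifted n k))\<^sup>2) \<le> 1"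
  using sum_norm2_shifted_combination_le[of "{n}" "\<lambda>_. 1" K] by simp

lemma summable_norm2_shifted: "summable (\<lambda>k. (norm (shifted n k))\<^sup>2)"
  by (rule summableI_nonneg_bounded[OF _ sum_norm2_shifted_le_1]) auto

text \<open>For polynomial \<open>H\<close> this is linearity. In general the tail of
  \<open>H\<close> has small norm, multiplication by b does not enlarge it, and Cauchy-Schwarz
  bounds its pairing with \<open>a\<close> uniformly in the summation range.\<close>

lemma orthogonal_to_multiples:
  fixes a :: "nat \<Rightarrow> complex"
  assumes a: "summable (\<lambda>k. (norm (a k))\<^sup>2)"
    and h: "summable (\<lambda>k. (norm (fps_nth H k))\<^sup>2)"
    and orth: "\<And>n. (\<lambda>k. a k * cnj (shifted n k)) sums 0"
  shows "(\<lambda>k. a k * cnj (fps_nth (B * H) k)) sums 0"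
  unfolding sums_def
proof (rule tendsto_zero_approx)
  fix e :: real assume e: "e > 0"
  \<comment> \<open>The summand 1 keeps \<open>A\<close> positive when \<open>a\<close> vanishes;
    the tail bound e^2 / A is chosen to give e^2 after Cauchy-Schwarz.\<close>
  define A where "A = (\<Sum>k. (norm (a k))\<^sup>2) + 1"
  have A: "A > 0" using suminf_nonneg[OF a] by (simp add: A_def)
  have A_ge: "(\<Sum>k<K. (norm (a k))\<^sup>2) \<le> A" for K
    using sum_le_suminf[OF a, of "{..<K}"] by (simp add: A_def)
  obtain N where N: "\<And>m n. m \<ge> N \<Longrightarrow> (\<Sum>j=m..<n. (norm (fps_nth H j))\<^sup>2) < e\<^sup>2 / A"
    by (rule summable_tail_small[OF h, of "e\<^sup>2 / A"]) (use e A in auto)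
  define Y where "Y K = (\<Sum>k<K. a k * cnj (\<Sum>j<N. fps_nth H j * shifted j k))" for K
  have "(\<lambda>k. \<Sum>j<N. cnj (fps_nth H j) * (a k * cnj (shifted j k))) sums (\<Sum>j<N. cnj (fps_nth H j) * 0)"
    by (intro sums_sum sums_mult orth)
  then have "(\<lambda>k. a k * cnj (\<Sum>j<N. fps_nth H j * shifted j k)) sums 0"
    by (simp add: sum_distrib_left mult_ac)
  then have "Y \<longlonglongrightarrow> 0"
    by (simp add: sums_def Y_def[abs_def])
  moreover have "norm ((\<Sum>k<K. a k * cnj (fps_nth (B * H) k)) - Y K) \<le> e" if K: "K \<ge> N" for K
  proof -
    \<comment> \<open>Coefficients below K involve \<open>H\<close> only below K, so the tail of
      \<open>H\<close> contributes a finite sum and the isometry for polynomials applies.\<close>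
    have split: "fps_nth (B * H) k - (\<Sum>j<N. fps_nth H j * shifted j k) = (\<Sum>j\<in>{N..<K}. fps_nth H j * shifted j k)" if "k < K" for k
    proof -
      have "fps_nth (B * H) k = (\<Sum>j<K. fps_nth H j * shifted j k)"
        using that by (intro mult_nth_shifted) auto
      also have "{..<K} = {..<N} \<union> {N..<K}" using K by auto
      finally show ?thesis by (subst (asm) sum.union_disjoint) auto
    qed
    have "(\<Sum>k<K. a k * cnj (fps_nth (B * H) k)) - Y K = (\<Sum>k<K. a k * cnj (\<Sum>j\<in>{N..<K}. fps_nth H j * shifted j k))"
      unfolding Y_def sum_subtractf[symmetric] right_diff_distrib[symmetric] complex_cnj_diff[symmetric]
      by (intro sum.cong refl arg_cong2[where f = "(*)"] arg_cong[where f = cnj] split) simp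
    then have "(norm ((\<Sum>k<K. a k * cnj (fps_nth (B * H) k)) - Y K))\<^sup>2
        \<le> (\<Sum>k<K. (norm (a k))\<^sup>2) * (\<Sum>k<K. (norm (\<Sum>j\<in>{N..<K}. fps_nth H j * shifted j k))\<^sup>2)"
      by (simp only: Cauchy_Schwarz_sum_complex)
    also have "\<dots> \<le> A * (e\<^sup>2 / A)"
      using A A_ge sum_norm2_shifted_combination_le[of "{N..<K}" "fps_nth H" K] N[of N K]
      by (intro mult_mono) (auto intro: sum_nonneg)
    also have "\<dots> = e\<^sup>2" using A by simp
    finally show ?thesis by (rule power2_le_imp_le) (use e in simp)
  qed
  then have "\<forall>\<^sub>F K in sequentially. norm ((\<Sum>k<K. a k * cnj (fps_nth (B * H) k)) - Y K) \<le> e"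
    using eventually_sequentially by blast
  ultimately show "\<exists>Y. Y \<longlonglongrightarrow> 0 \<and> (\<forall>\<^sub>F K in sequentially. norm ((\<Sum>k<K. a k * cnj (fps_nth (B * H) k)) - Y K) \<le> e)"
    by blast
qed

end

section \<open>Clark measures and the normalised Cauchy transform\<close>

text \<open>The series in \<open>clark_eq\<close> is that of \<open>mu_plus\<close>, so the
  assumption reads 1 - b = 1 / mu_plus and makes \<mu> a Clark measure of b. As a formal identity it
  also applies to products with series that may diverge.\<close>

locale clark_system = prob_space \<mu> + inner_coeffs B for \<mu> :: "real measure" and B :: "complex fps" +
  assumes sets_eq [measurable_cong, simp]: "sets \<mu> = sets borel"
    and clark_eq: "(1 - B) * Abs_fps (\<lambda>n. LINT x|\<mu>. cis (- 2 * pi * real n * x)) = 1"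
begin

definition moment :: "nat \<Rightarrow> complex" where
  "moment n = (LINT x|\<mu>. cis (- 2 * pi * real n * x))"

definition trig :: "nat \<Rightarrow> real \<Rightarrow> complex" where
  "trig n x = cis (2 * pi * real n * x)"

abbreviation ip :: "(real \<Rightarrow> complex) \<Rightarrow> (real \<Rightarrow> complex) \<Rightarrow> complex" where
  "ip \<equiv> L2_inner \<mu>"

abbreviation sqn :: "(real \<Rightarrow> complex) \<Rightarrow> real" where
  "sqn \<equiv> L2_sqnorm \<mu>"

text \<open>The inner products are the Taylor coefficients of the Cauchy transform of f d\<mu>;
  multiplication by 1 - b divides it by the Cauchy transform of \<mu>.\<close>

definition coef :: "(real \<Rightarrow> complex) \<Rightarrow> nat \<Rightarrow> complex" where
  "coef f k = fps_nth ((1 - B) * Abs_fps (\<lambda>n. ip f (trig n))) k"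

text \<open>The vector that represents the k-th coefficient, conjugated because the inner product is
  conjugate linear in its second argument. These vectors are the auxiliary sequence of the Kaczmarz
  algorithm.\<close>

definition dual_poly :: "nat \<Rightarrow> real \<Rightarrow> complex" where
  "dual_poly k x = (\<Sum>j\<in>{0..k}. cnj (fps_nth (1 - B) (k - j)) * trig j x)"

lemma clark_eq': "(1 - B) * Abs_fps moment = 1"
  using clark_eq by (simp add: moment_def[abs_def])

lemma moment_0: "moment 0 = 1"
  by (simp add: moment_def prob_space)

lemma in_L2_trig: "in_L2 \<mu> (trig n)"
  unfolding in_L2_def trig_def by (auto intro!: integrable_const_bound[where B = 1])

lemma in_L2_dual_poly: "in_L2 \<mu> (dual_poly k)"
  unfolding dual_poly_def by (intro in_L2_sum in_L2_cmult in_L2_trig)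

lemma sqn_trig: "sqn (trig n) = 1"
  by (simp add: L2_sqnorm_def trig_def prob_space)

lemma ip_trig_trig: "ip (trig i) (trig j) = (if j < i then cnj (moment (i - j)) else moment (j - i))"
proof (cases "j < i")
  case True
  have "(\<lambda>x. trig i x * cnj (trig j x)) = (\<lambda>x. cnj (cis (- 2 * pi * real (i - j) * x)))"
    using True by (auto simp: trig_def cis_cnj cis_mult of_nat_diff algebra_simps)
  then show ?thesis
    using True unfolding L2_inner_def moment_def Bochner_Integration.integral_cnj[symmetric] by simp
next
  case False
  have "(\<lambda>x. trig i x * cnj (trig j x)) = (\<lambda>x. cis (- 2 * pi * real (j - i) * x))"
    using False by (auto simp: trig_def cis_cnj cis_mult of_nat_diff algebra_simps)
  then show ?thesis
    using False unfolding L2_inner_def moment_def by simp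
qed

lemma coef_eq_ip: 
  assumes "in_L2 \<mu> f"
  shows "coef f k = ip f (dual_poly k)"
proof -
  have "coef f k = (\<Sum>j\<in>{0..k}. ip f (trig j) * fps_nth (1 - B) (k - j))"
    unfolding coef_def mult.commute[of "1 - B"] by (simp only: fps_mult_nth fps_nth_Abs_fps)
  also have "\<dots> = ip f (dual_poly k)"
    unfolding dual_poly_def
    by (subst L2_inner_sum_right[OF in_L2_trig assms]) (simp only: complex_cnj_cnj mult.commute)
  finally show ?thesis .
qed

text \<open>Multiplication by the moment series undoes multiplication by 1 - B.\<close>

lemma ip_trig_eq_sum_coef: "ip f (trig n) = (\<Sum>j\<in>{0..n}. coef f j * moment (n - j))"
proof -
  have "Abs_fps (coef f) * Abs_fps moment = Abs_fps (\<lambda>n. ip f (trig n)) * ((1 - B) * Abs_fps moment)"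
    by (simp add: coef_def[abs_def] fps_nth_inverse mult_ac)
  then have "Abs_fps (coef f) * Abs_fps moment = Abs_fps (\<lambda>n. ip f (trig n))"
    by (simp add: clark_eq')
  then have "fps_nth (Abs_fps (coef f) * Abs_fps moment) n = ip f (trig n)"
    by simp
  then show ?thesis by (simp add: fps_mult_nth)
qed

text \<open>The partial sums of \<open>\<Sum>n. coef f n * trig n\<close> are the iterates of the Kaczmarz algorithm for the
  unit vectors \<open>trig 0, trig 1, \<dots>\<close>: each step subtracts the projection of the error onto the next
  vector, so the loss of energy is exactly \<open>(norm (coef f N))\<^sup>2\<close>.\<close>

lemma kaczmarz:
  assumes f: "in_L2 \<mu> f"
  shows "sqn (\<lambda>x. f x - (\<Sum>n<N. coef f n * trig n x)) + (\<Sum>n<N. (norm (coef f n))\<^sup>2) = sqn f"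
proof (induction N)
  case 0
  show ?case by simp
next
  case (Suc N)
  define s where "s = (\<lambda>x. \<Sum>n<N. coef f n * trig n x)"
  have s: "in_L2 \<mu> s" unfolding s_def by (intro in_L2_sum in_L2_cmult in_L2_trig)
  define g where "g = (\<lambda>x. f x - s x)"
  have g: "in_L2 \<mu> g" unfolding g_def by (rule in_L2_diff[OF f s])
  have "ip s (trig N) = (\<Sum>n<N. coef f n * moment (N - n))"
    unfolding s_def
    by (subst L2_inner_sum_left) (auto simp: L2_inner_cmult_left ip_trig_trig intro!: in_L2_trig in_L2_cmult)
  moreover have "ip f (trig N) = (\<Sum>n<N. coef f n * moment (N - n)) + coef f N"
    unfolding ip_trig_eq_sum_coef by (simp add: atLeast0AtMost lessThan_Suc_atMost[symmetric] moment_0)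
  \<comment> \<open>The diagonal entry \<open>moment 0\<close> of the triangular system is 1, so
    what remains of the inner product is the new coefficient itself.\<close>
  ultimately have c: "ip g (trig N) = coef f N"
    unfolding g_def by (simp add: L2_inner_diff_left[OF f s in_L2_trig])
  have "cnj (coef f N) * coef f N = of_real ((norm (coef f N))\<^sup>2)"
    by (simp add: complex_norm_square mult.commute del: of_real_power)
  then have "sqn (\<lambda>x. g x - coef f N * trig N x) = sqn g - (norm (coef f N))\<^sup>2"
    by (subst L2_sqnorm_diff_cmult[OF g in_L2_trig]) (simp add: c sqn_trig del: of_real_power)
  moreover have "(\<lambda>x. f x - (\<Sum>n<Suc N. coef f n * trig n x)) = (\<lambda>x. g x - coef f N * trig N x)"
    by (auto simp: g_def s_def)
  moreover have "sqn g + (\<Sum>n<N. (norm (coef f n))\<^sup>2) = sqn f"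
    using Suc.IH by (simp add: g_def s_def)
  ultimately show ?case by simp
qed

lemma bessel: "in_L2 \<mu> f \<Longrightarrow> (\<Sum>n<N. (norm (coef f n))\<^sup>2) \<le> sqn f"
  using kaczmarz[of f N] L2_sqnorm_nonneg[of \<mu> "\<lambda>x. f x - (\<Sum>n<N. coef f n * trig n x)"] by linarith

lemma summable_norm2_coef: "in_L2 \<mu> f \<Longrightarrow> summable (\<lambda>n. (norm (coef f n))\<^sup>2)"
  by (rule summableI_nonneg_bounded[OF _ bessel]) auto

text \<open>Bessel's inequality for the adjoint: the squared norm of the combination h is the
  pairing of \<open>a\<close> with \<open>coef h\<close>; apply Cauchy-Schwarz and Bessel to h, then
  cancel one factor \<open>sqn h\<close>.\<close>

lemma sqn_dual_poly_combination_le: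
  assumes "finite I"
  shows "sqn (\<lambda>x. \<Sum>k\<in>I. a k * dual_poly k x) \<le> (\<Sum>k\<in>I. (norm (a k))\<^sup>2)"
proof -
  define h where "h = (\<lambda>x. \<Sum>k\<in>I. a k * dual_poly k x)"
  have h: "in_L2 \<mu> h" unfolding h_def by (intro in_L2_sum in_L2_cmult in_L2_dual_poly)
  have "ip h h = (\<Sum>k\<in>I. a k * cnj (coef h k))"
  proof -
    have "ip h h = (\<Sum>k\<in>I. a k * ip (dual_poly k) h)"
      by (subst (1) h_def, subst L2_inner_sum_left)
         (auto simp: L2_inner_cmult_left intro!: in_L2_dual_poly in_L2_cmult h)
    also have "\<dots> = (\<Sum>k\<in>I. a k * cnj (coef h k))"
      by (intro sum.cong refl) (simp add: coef_eq_ip[OF h] L2_inner_commute[of \<mu> "dual_poly _" h])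
    finally show ?thesis .
  qed
  then have "(sqn h)\<^sup>2 = (norm (\<Sum>k\<in>I. a k * cnj (coef h k)))\<^sup>2"
    unfolding L2_inner_self by (metis norm_of_real power2_abs)
  also have "\<dots> \<le> (\<Sum>k\<in>I. (norm (a k))\<^sup>2) * (\<Sum>k\<in>I. (norm (coef h k))\<^sup>2)"
    by (rule Cauchy_Schwarz_sum_complex)
  also have "\<dots> \<le> (\<Sum>k\<in>I. (norm (a k))\<^sup>2) * sqn h"
  proof (intro mult_left_mono sum_nonneg)
    obtain N where "I \<subseteq> {..<N}" using assms finite_nat_iff_bounded by blast
    then have "(\<Sum>k\<in>I. (norm (coef h k))\<^sup>2) \<le> (\<Sum>k<N. (norm (coef h k))\<^sup>2)"
      by (intro sum_mono2) auto
    then show "(\<Sum>k\<in>I. (norm (coef h k))\<^sup>2) \<le> sqn h" using bessel[OF h, of N] by linarith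
  qed auto
  finally have le: "sqn h * sqn h \<le> (\<Sum>k\<in>I. (norm (a k))\<^sup>2) * sqn h"
    by (simp add: power2_eq_square)
  have nn: "(\<Sum>k\<in>I. (norm (a k))\<^sup>2) \<ge> 0" by (intro sum_nonneg) auto
  show ?thesis
  proof (cases "sqn h = 0")
    case True
    then show ?thesis using nn by (simp add: h_def)
  next
    case False
    then have "sqn h > 0" using L2_sqnorm_nonneg[of \<mu> h] by linarith
    with le show ?thesis unfolding h_def by (simp only: mult_le_cancel_right)
  qed
qed

text \<open>As a function, the image of \<open>trig m\<close> is Q + z^m - b Q with a polynomial Q
  of degree below m. The term z^m is absorbed into the case k = m, because \<open>moment 0\<close> =
  1.\<close>

lemma coef_trig:
  "coef (trig m) k = (if k \<le> m then cnj (moment (m - k)) else 0) - (\<Sum>j<m. cnj (moment (m - j)) * shifted j k)"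
proof -
  \<comment> \<open>The inner products with n < m form Q; those with n \<ge> m form z^m times the
    moment series, which 1 - B turns into z^m.\<close>
  define Q where "Q = Abs_fps (\<lambda>n. if n < m then cnj (moment (m - n)) else 0)"
  have "Abs_fps (\<lambda>n. ip (trig m) (trig n)) = Q + fps_X ^ m * Abs_fps moment"
    by (rule fps_ext) (auto simp: Q_def ip_trig_trig fps_X_power_mult_nth)
  then have "(1 - B) * Abs_fps (\<lambda>n. ip (trig m) (trig n)) = Q - B * Q + fps_X ^ m * ((1 - B) * Abs_fps moment)"
    by (simp add: algebra_simps)
  then have "coef (trig m) k = fps_nth Q k - fps_nth (B * Q) k + fps_nth (fps_X ^ m) k"
    unfolding coef_def clark_eq' by simp
  moreover have "fps_nth (B * Q) k = (\<Sum>j<m. cnj (moment (m - j)) * shifted j k)"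
    by (subst mult_nth_shifted[where J = "{..<m}"]) (auto simp: Q_def)
  ultimately show ?thesis
    by (auto simp: Q_def moment_0 fps_X_power_nth)
qed

text \<open>Two terms cancel. Pairing Q + z^m with z^n b gives the conjugate of the m-th coefficient
  of z^n b mu_plus; pairing b Q with z^n b gives the n-th coefficient of Q by
  orthonormality.\<close>

lemma coef_trig_orthogonal: "(\<lambda>k. coef (trig m) k * cnj (shifted n k)) sums 0"
proof -
  define q where "q k = (if k \<le> m then cnj (moment (m - k)) else 0)" for k
  have "(\<lambda>k. q k * cnj (shifted n k)) sums (\<Sum>k\<in>{0..m}. q k * cnj (shifted n k))"
    by (rule sums_finite) (auto simp: q_def)
  moreover have "(\<Sum>k\<in>{0..m}. q k * cnj (shifted n k)) = cnj (fps_nth (fps_X ^ n * B * Abs_fps moment) m)"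
    unfolding fps_mult_nth[of "fps_X ^ n * B" "Abs_fps moment"] cnj_sum
    by (auto simp: shifted_def q_def intro!: sum.cong)
  \<comment> \<open>Subtracting 1 removes the constant term of the moment series, so the case n = m
    contributes 0, in agreement with Q.\<close>
  moreover have "B * Abs_fps moment = Abs_fps moment - 1"
    using clark_eq' by algebra
  then have "fps_X ^ n * B * Abs_fps moment = fps_X ^ n * (Abs_fps moment - 1)"
    by (simp only: mult.assoc)
  ultimately have "(\<lambda>k. q k * cnj (shifted n k)) sums (if n < m then cnj (moment (m - n)) else 0)"
    by (auto simp: fps_X_power_mult_nth moment_0 split: if_splits)
  moreover have "(\<lambda>k. \<Sum>j<m. cnj (moment (m - j)) * (shifted j k * cnj (shifted n k))) sums
      (\<Sum>j<m. cnj (moment (m - j)) * (if j = n then 1 else 0))"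
    by (intro sums_sum sums_mult shifted_orthonormal)
  moreover have "(\<Sum>j<m. cnj (moment (m - j)) * (if j = n then 1 else 0)) = (if n < m then cnj (moment (m - n)) else 0)"
    by (simp add: if_distrib cong: if_cong)
  ultimately have "(\<lambda>k. q k * cnj (shifted n k) - (\<Sum>j<m. cnj (moment (m - j)) * (shifted j k * cnj (shifted n k)))) sums 0"
    using sums_diff by fastforce
  then show ?thesis
    by (simp add: coef_trig q_def left_diff_distrib sum_distrib_right mult.assoc)
qed

text \<open>The partial pairings are inner products of f with \<open>u K\<close>, the adjoint of the
  coefficient map applied to the truncations of z^n b. It is therefore enough that
  \<open>u K\<close> tends to 0 in norm.\<close>

lemma coef_orthogonal:
  assumes f: "in_L2 \<mu> f"
  shows "(\<lambda>k. coef f k * cnj (shifted n k)) sums 0"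
proof -
  define u where "u K = (\<lambda>x. \<Sum>k<K. shifted n k * dual_poly k x)" for K
  have u: "in_L2 \<mu> (u K)" for K unfolding u_def by (intro in_L2_sum in_L2_cmult in_L2_dual_poly)
  have ip_u: "ip h (u K) = (\<Sum>k<K. coef h k * cnj (shifted n k))" if "in_L2 \<mu> h" for h K
    unfolding u_def using that
    by (subst L2_inner_sum_right) (auto simp: coef_eq_ip mult.commute in_L2_dual_poly)
  have ip_trig_u: "(\<lambda>K. ip (trig j) (u K)) \<longlonglongrightarrow> 0" for j
    using coef_trig_orthogonal[of j n] by (simp add: ip_u[OF in_L2_trig] sums_def)
  \<comment> \<open>For fixed \<open>L\<close>, the vector \<open>u L\<close> is a finite
    combination of the \<open>trig j\<close>.\<close>
  have ip_u_u: "(\<lambda>K. ip (u L) (u K)) \<longlonglongrightarrow> 0" for L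
  proof -
    have "ip (dual_poly k) (u K) = (\<Sum>j\<in>{0..k}. cnj (fps_nth (1 - B) (k - j)) * ip (trig j) (u K))" for k K
      unfolding dual_poly_def
      by (subst L2_inner_sum_left)
         (auto simp: L2_inner_cmult_left simp del: fps_sub_nth fps_one_nth intro!: in_L2_trig in_L2_cmult u)
    moreover have "ip (u L) (u K) = (\<Sum>k<L. shifted n k * ip (dual_poly k) (u K))" for K
      unfolding u_def[of L] by (subst L2_inner_sum_left) (auto simp: L2_inner_cmult_left intro!: in_L2_dual_poly in_L2_cmult u)
    ultimately show ?thesis
      by (auto intro!: tendsto_null_sum tendsto_mult_right_zero ip_trig_u)
  qed
  have sqn_u: "sqn (u K) \<le> 1" for K
    unfolding u_def using sqn_dual_poly_combination_le[of "{..<K}" "shifted n"] sum_norm2_shifted_le_1[of n K] by simp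
  \<comment> \<open>\<open>u\<close> is Cauchy, its limit is in the closed span of the \<open>trig j\<close> and orthogonal to each of them.\<close>
  have "(\<lambda>K. ip (u K) (u K)) \<longlonglongrightarrow> 0"
  proof (rule tendsto_zero_approx)
    fix \<epsilon> :: real assume \<epsilon>: "\<epsilon> > 0"
    obtain L where L: "\<And>m k. m \<ge> L \<Longrightarrow> (\<Sum>j=m..<k. (norm (shifted n j))\<^sup>2) < \<epsilon>\<^sup>2"
      by (rule summable_tail_small[OF summable_norm2_shifted[of n], of "\<epsilon>\<^sup>2"]) (use \<epsilon> in auto)
    have "norm (ip (u K) (u K) - ip (u L) (u K)) \<le> \<epsilon>" if K: "K \<ge> L" for K
    proof -
      have d: "(\<lambda>x. u K x - u L x) = (\<lambda>x. \<Sum>k\<in>{L..<K}. shifted n k * dual_poly k x)"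
      proof
        fix x
        have "u K x = u L x + (\<Sum>k\<in>{L..<K}. shifted n k * dual_poly k x)"
          unfolding u_def lessThan_atLeast0 using K by (simp only: sum.atLeastLessThan_concat)
        then show "u K x - u L x = (\<Sum>k\<in>{L..<K}. shifted n k * dual_poly k x)" by simp
      qed
      have "(norm (ip (u K) (u K) - ip (u L) (u K)))\<^sup>2 = (norm (ip (\<lambda>x. u K x - u L x) (u K)))\<^sup>2"
        by (simp add: L2_inner_diff_left[OF u u u])
      also have "\<dots> \<le> sqn (\<lambda>x. u K x - u L x) * sqn (u K)"
        by (rule L2_Cauchy_Schwarz[OF in_L2_diff[OF u u] u])
      also have "\<dots> \<le> \<epsilon>\<^sup>2 * 1"
      proof (rule mult_mono[OF _ sqn_u])
        show "sqn (\<lambda>x. u K x - u L x) \<le> \<epsilon>\<^sup>2"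
          unfolding d using sqn_dual_poly_combination_le[of "{L..<K}" "shifted n"] L[of L K] by simp
      qed auto
      finally have "(norm (ip (u K) (u K) - ip (u L) (u K)))\<^sup>2 \<le> \<epsilon>\<^sup>2" by simp
      then show ?thesis by (rule power2_le_imp_le) (use \<epsilon> in simp)
    qed
    then have "\<forall>\<^sub>F K in sequentially. norm (ip (u K) (u K) - ip (u L) (u K)) \<le> \<epsilon>"
      using eventually_sequentially by blast
    with ip_u_u show "\<exists>Y. Y \<longlonglongrightarrow> 0 \<and> (\<forall>\<^sub>F K in sequentially. norm (ip (u K) (u K) - Y K) \<le> \<epsilon>)"
      by blast
  qed
  from tendsto_Re[OF this] have sqn0: "(\<lambda>K. sqn (u K)) \<longlonglongrightarrow> 0"
    by (simp add: L2_inner_self)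
  have "(\<lambda>K. (norm (ip f (u K)))\<^sup>2) \<longlonglongrightarrow> 0"
  proof (rule Lim_null_comparison)
    show "(\<lambda>K. sqn f * sqn (u K)) \<longlonglongrightarrow> 0"
      using tendsto_mult_right_zero[OF sqn0] .
    show "\<forall>\<^sub>F K in sequentially. norm ((norm (ip f (u K)))\<^sup>2) \<le> sqn f * sqn (u K)"
      using L2_Cauchy_Schwarz[OF f u] by simp
  qed
  then have "(\<lambda>K. ip f (u K)) \<longlonglongrightarrow> 0"
    by (simp add: tendsto_norm_zero_iff)
  then show ?thesis
    by (simp add: ip_u[OF f] sums_def)
qed

text \<open>f is the limit of the combinations of \<open>dual_poly\<close> with coefficients
  \<open>a\<close>, a Cauchy sequence by the dual Bessel inequality. The conclusion says that the
  inner products with \<open>trig m\<close> form the series of \<open>a\<close> times the moment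
  series, which is equivalent to \<open>coef f = a\<close>.\<close>

lemma coef_surjective:
  assumes a: "summable (\<lambda>k. (norm (a k))\<^sup>2)"
    and orth: "\<And>n. (\<lambda>k. a k * cnj (shifted n k)) sums 0"
  obtains f where "in_L2 \<mu> f" "\<And>m. ip f (trig m) = (\<Sum>k\<in>{0..m}. a k * moment (m - k))"
proof -
  define u where "u K = (\<lambda>x. \<Sum>k<K. a k * dual_poly k x)" for K
  have u: "in_L2 \<mu> (u K)" for K unfolding u_def by (intro in_L2_sum in_L2_cmult in_L2_dual_poly)
  have u_diff: "sqn (\<lambda>x. u i x - u j x) \<le> (\<Sum>k=min i j..<max i j. (norm (a k))\<^sup>2)" for i j
  proof -
    have le: "sqn (\<lambda>x. u i x - u j x) \<le> (\<Sum>k=j..<i. (norm (a k))\<^sup>2)" if "j \<le> i" for i j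
    proof -
      have d: "(\<lambda>x. u i x - u j x) = (\<lambda>x. \<Sum>k\<in>{j..<i}. a k * dual_poly k x)"
      proof
        fix x
        have "u i x = u j x + (\<Sum>k\<in>{j..<i}. a k * dual_poly k x)"
          unfolding u_def lessThan_atLeast0 using that by (simp only: sum.atLeastLessThan_concat)
        then show "u i x - u j x = (\<Sum>k\<in>{j..<i}. a k * dual_poly k x)" by simp
      qed
      show ?thesis unfolding d by (rule sqn_dual_poly_combination_le) auto
    qed
    have sym: "sqn (\<lambda>x. u i x - u j x) = sqn (\<lambda>x. u j x - u i x)"
      by (simp add: L2_sqnorm_def norm_minus_commute)
    show ?thesis
    proof (cases "j \<le> i")
      case True
      then show ?thesis using le[of j i] by (simp only: min_absorb2 max_absorb1)
    next
      case False
      then have "i \<le> j" by simp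
      then show ?thesis using le[of i j] unfolding sym by (simp only: min_absorb1 max_absorb2)
    qed
  qed
  obtain f where f: "in_L2 \<mu> f" and lim: "(\<lambda>n. sqn (\<lambda>x. u n x - f x)) \<longlonglongrightarrow> 0"
  proof (rule L2_complete[OF prob_space_axioms u])
    fix \<epsilon> :: real assume \<epsilon>: "\<epsilon> > 0"
    obtain N where N: "\<And>m n. m \<ge> N \<Longrightarrow> (\<Sum>k=m..<n. (norm (a k))\<^sup>2) < \<epsilon>"
      by (rule summable_tail_small[OF a, of \<epsilon>]) (use \<epsilon> in auto)
    show "\<exists>N. \<forall>i\<ge>N. \<forall>j\<ge>N. sqn (\<lambda>x. u i x - u j x) < \<epsilon>"
      by (intro exI[of _ N] allI impI order_le_less_trans[OF u_diff N]) auto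
  qed blast
  have "ip f (trig m) = (\<Sum>k\<in>{0..m}. a k * moment (m - k))" for m
  proof -
    have "(\<lambda>k. a k * cnj (if k \<le> m then cnj (moment (m - k)) else 0)) sums
        (\<Sum>k\<in>{0..m}. a k * cnj (if k \<le> m then cnj (moment (m - k)) else 0))"
      by (rule sums_finite) auto
    \<comment> \<open>The part of \<open>coef (trig m)\<close> in b H^2 drops out by
      \<open>orth\<close>; only the finite sum above survives.\<close>
    moreover have "(\<lambda>k. \<Sum>j<m. moment (m - j) * (a k * cnj (shifted j k))) sums (\<Sum>j<m. moment (m - j) * 0)"
      by (intro sums_sum sums_mult orth)
    ultimately have "(\<lambda>k. a k * cnj (if k \<le> m then cnj (moment (m - k)) else 0) - (\<Sum>j<m. moment (m - j) * (a k * cnj (shifted j k))))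
        sums ((\<Sum>k\<in>{0..m}. a k * cnj (if k \<le> m then cnj (moment (m - k)) else 0)) - (\<Sum>j<m. moment (m - j) * 0))"
      by (rule sums_diff)
    moreover have "a k * cnj (if k \<le> m then cnj (moment (m - k)) else 0) - (\<Sum>j<m. moment (m - j) * (a k * cnj (shifted j k)))
        = a k * cnj (coef (trig m) k)" for k
      by (simp add: coef_trig right_diff_distrib sum_distrib_left mult.left_commute)
    moreover have "(\<Sum>k\<in>{0..m}. a k * cnj (if k \<le> m then cnj (moment (m - k)) else 0)) =
        (\<Sum>k\<in>{0..m}. a k * moment (m - k))"
      by (intro sum.cong) auto
    ultimately have "(\<lambda>k. a k * cnj (coef (trig m) k)) sums (\<Sum>k\<in>{0..m}. a k * moment (m - k))"
      by simp
    moreover have "ip (u N) (trig m) = (\<Sum>k<N. a k * cnj (coef (trig m) k))" for N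
      unfolding u_def
      by (subst L2_inner_sum_left)
         (auto simp: L2_inner_cmult_left coef_eq_ip[OF in_L2_trig] L2_inner_commute[of \<mu> "dual_poly _" "trig m"] intro!: in_L2_dual_poly in_L2_cmult in_L2_trig)
    ultimately have 1: "(\<lambda>N. ip (u N) (trig m)) \<longlonglongrightarrow> (\<Sum>k\<in>{0..m}. a k * moment (m - k))"
      by (simp add: sums_def)
    have "(\<lambda>N. (norm (ip (u N) (trig m) - ip f (trig m)))\<^sup>2) \<longlonglongrightarrow> 0"
    proof (rule Lim_null_comparison[OF _ lim])
      have "(norm (ip (u N) (trig m) - ip f (trig m)))\<^sup>2 \<le> sqn (\<lambda>x. u N x - f x)" for N
        using L2_Cauchy_Schwarz[OF in_L2_diff[OF u[of N] f] in_L2_trig[of m]]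
        by (simp add: L2_inner_diff_left[OF u f in_L2_trig] sqn_trig)
      then show "\<forall>\<^sub>F N in sequentially. norm ((norm (ip (u N) (trig m) - ip f (trig m)))\<^sup>2) \<le> sqn (\<lambda>x. u N x - f x)"
        by simp
    qed
    then have "(\<lambda>N. ip (u N) (trig m) - ip f (trig m)) \<longlonglongrightarrow> 0"
      by (simp add: tendsto_norm_zero_iff)
    then have "(\<lambda>N. ip (u N) (trig m)) \<longlonglongrightarrow> ip f (trig m)"
      by (rule LIM_zero_cancel)
    then show ?thesis using 1 LIMSEQ_unique by blast
  qed
  with f show ?thesis by (rule that)
qed

end

section \<open>Indicator functions\<close>

text \<open>The complement is the union of all open null sets, and by Lindelof countably many of
  them suffice.\<close>

lemma emeasure_compl_msupport:
  fixes M :: "'a::second_countable_topology measure"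
  assumes sets: "sets M = sets borel"
  shows "emeasure M (- msupport M) = 0"
proof -
  define \<U> where "\<U> = {U. open U \<and> emeasure M U = 0}"
  obtain \<V> where V: "\<V> \<subseteq> \<U>" "countable \<V>" "\<Union>\<V> = \<Union>\<U>"
    by (rule Lindelof[of \<U>]) (auto simp: \<U>_def)
  have "(\<Union>U\<in>\<V>. U) \<in> null_sets M"
  proof (rule null_sets_UN'[OF V(2)])
    fix U assume "U \<in> \<V>"
    then have "open U" "emeasure M U = 0" using V(1) by (auto simp: \<U>_def)
    then show "U \<in> null_sets M" by (auto simp: null_sets_def sets)
  qed
  moreover have "- msupport M = (\<Union>U\<in>\<V>. U)"
    using V(3) by (auto simp: msupport_def \<U>_def zero_less_iff_neq_zero)
  ultimately show ?thesis by auto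
qed

lemma indicator_PL_le:
  assumes "\<And>r. r \<ge> 0 \<Longrightarrow> norm (F (of_real r * cis \<theta>)) \<le> C * exp (h * r)"
  shows "indicator_PL F \<theta> \<le> ereal h"
  unfolding indicator_PL_def Limsup_le_iff
proof (intro allI impI)
  fix y assume y: "ereal h < y"
  \<comment> \<open>Positive, so that its logarithm can be split off; ln D / r then vanishes in the
    limit.\<close>
  define D where "D = max C 1"
  obtain s where s: "h < s" "ereal s < y"
    using ereal_dense2[OF y] by auto
  have "((\<lambda>r. ln D / r + h) \<longlongrightarrow> 0 + h) at_top"
    by (intro tendsto_add tendsto_const tendsto_divide_0[OF tendsto_const filterlim_at_top_imp_at_infinity] filterlim_ident)
  then have "\<forall>\<^sub>F r in at_top. ln D / r + h < s"
    using s by (auto dest: order_tendstoD)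
  with eventually_gt_at_top[of 0]
  show "\<forall>\<^sub>F r in at_top. (if F (of_real r * cis \<theta>) = 0 then - \<infinity>
      else ereal (ln (norm (F (of_real r * cis \<theta>))) / r)) < y"
  proof eventually_elim
    case (elim r)
    show ?case
    proof (cases "F (of_real r * cis \<theta>) = 0")
      case True
      then show ?thesis using y by (cases y) auto
    next
      case False
      have "norm (F (of_real r * cis \<theta>)) \<le> D * exp (h * r)"
        using assms[of r] elim by (auto simp: D_def elim!: order_trans intro!: mult_right_mono)
      then have "ln (norm (F (of_real r * cis \<theta>))) \<le> ln (D * exp (h * r))"
        using False by (subst ln_le_cancel_iff) (auto simp: D_def)
      also have "\<dots> = ln D + h * r" by (subst ln_mult) (auto simp: D_def)
      finally have "ln (norm (F (of_real r * cis \<theta>))) / r \<le> ln D / r + h"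
        using elim by (simp add: field_simps)
      then have "ln (norm (F (of_real r * cis \<theta>))) / r < s" using elim by linarith
      then show ?thesis using False s by (auto intro: order_less_trans[of _ "ereal s"])
    qed
  qed
qed

text \<open>The indicator controls only large radii, at the price of \<epsilon>; compactness of the
  remaining segment supplies the constant.\<close>

lemma indicator_PL_bound:
  assumes hol: "F holomorphic_on UNIV" and ind: "indicator_PL F \<theta> \<le> ereal h" and \<epsilon>: "\<epsilon> > 0"
  obtains C where "C \<ge> 0" "\<And>r. r \<ge> 0 \<Longrightarrow> norm (F (of_real r * cis \<theta>)) \<le> C * exp ((h + \<epsilon>) * r)"
proof -
  have "\<forall>\<^sub>F r in at_top. (if F (of_real r * cis \<theta>) = 0 then - \<infinity>
      else ereal (ln (norm (F (of_real r * cis \<theta>))) / r)) < ereal (h + \<epsilon>)"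
    using ind \<epsilon> unfolding indicator_PL_def Limsup_le_iff by auto
  with eventually_gt_at_top[of 0]
  have "\<forall>\<^sub>F r in at_top. norm (F (of_real r * cis \<theta>)) \<le> exp ((h + \<epsilon>) * r)"
  proof eventually_elim
    case (elim r)
    show ?case
    proof (cases "F (of_real r * cis \<theta>) = 0")
      case False
      with elim have "ln (norm (F (of_real r * cis \<theta>))) < (h + \<epsilon>) * r"
        by (auto simp: divide_less_eq)
      then have "exp (ln (norm (F (of_real r * cis \<theta>)))) \<le> exp ((h + \<epsilon>) * r)" by simp
      then show ?thesis using False by simp
    qed simp
  qed
  then obtain R where R: "\<And>r. r \<ge> R \<Longrightarrow> norm (F (of_real r * cis \<theta>)) \<le> exp ((h + \<epsilon>) * r)"
    by (auto simp: eventually_at_top_linorder)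
  define q where "q r = norm (F (of_real r * cis \<theta>)) * exp (- ((h + \<epsilon>) * r))" for r
  have "continuous_on {0..R} q"
    unfolding q_def
    by (intro continuous_intros continuous_on_compose2[OF holomorphic_on_imp_continuous_on[OF hol]]) auto
  then have "bounded (q ` {0..R})"
    by (intro compact_imp_bounded compact_continuous_image) auto
  then obtain K where K: "\<forall>r\<in>{0..R}. \<bar>q r\<bar> \<le> K"
    unfolding bounded_iff by auto
  show ?thesis
  proof
    show "max 1 K \<ge> 0" by simp
    fix r :: real assume r: "r \<ge> 0"
    have "q r \<le> max 1 K"
    proof (cases "r \<ge> R")
      case True
      have "q r \<le> exp ((h + \<epsilon>) * r) * exp (- ((h + \<epsilon>) * r))"
        unfolding q_def using R[OF True] by (intro mult_right_mono) auto
      then show ?thesis by (simp add: mult_exp_exp)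
    next
      case False
      then show ?thesis using K r by (auto simp: abs_le_iff intro: max.coboundedI2)
    qed
    then have "q r * exp ((h + \<epsilon>) * r) \<le> max 1 K * exp ((h + \<epsilon>) * r)"
      by (intro mult_right_mono) auto
    then show "norm (F (of_real r * cis \<theta>)) \<le> max 1 K * exp ((h + \<epsilon>) * r)"
      by (simp add: q_def mult.assoc mult_exp_exp)
  qed
qed

text \<open>Multiplication by \<open>exp (\<i> * pi * (\<alpha> + \<beta>) * z)\<close> makes the two indicator bounds equal to
  \<open>pi * (\<beta> - \<alpha>) < pi\<close>, as Carlson's theorem requires.\<close>

lemma carlson_indicator:
  assumes F: "F holomorphic_on UNIV" and H: "H holomorphic_on UNIV"
    and expF: "exponential_type F" and expH: "exponential_type H"
    and indF: "indicator_PL F (pi / 2) \<le> ereal (2 * pi * \<beta>)" "indicator_PL F (- pi / 2) \<le> ereal (- 2 * pi * \<alpha>)"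
    and indH: "indicator_PL H (pi / 2) \<le> ereal (2 * pi * \<beta>)" "indicator_PL H (- pi / 2) \<le> ereal (- 2 * pi * \<alpha>)"
    and width: "\<beta> - \<alpha> < 1"
    and eq: "\<And>n::nat. F (of_nat n) = H (of_nat n)"
  shows "F z = H z"
proof -
  \<comment> \<open>Half the gap between pi (\<beta> - \<alpha>) and pi, so that \<kappa> lies
    midway.\<close>
  define \<epsilon> where "\<epsilon> = pi * (1 - (\<beta> - \<alpha>)) / 2"
  have \<epsilon>: "\<epsilon> > 0" using width by (simp add: \<epsilon>_def)
  define \<kappa> where "\<kappa> = pi * (\<beta> - \<alpha>) + \<epsilon>"
  have "pi * (\<beta> - \<alpha>) < pi * 1" using width by (intro mult_strict_left_mono) auto
  then have \<kappa>: "\<kappa> < pi" by (simp add: \<kappa>_def \<epsilon>_def field_simps)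
  define c where "c = pi * (\<alpha> + \<beta>)"
  define \<Phi> where "\<Phi> z = (F z - H z) * exp (\<i> * of_real c * z)" for z
  have cis_half: "cis (pi / 2) = \<i>" "cis (- pi / 2) = - \<i>"
    by (simp_all add: complex_eq_iff)
  obtain C1 where C1: "C1 \<ge> 0" "\<And>r. r \<ge> 0 \<Longrightarrow> norm (F (of_real r * cis (pi / 2))) \<le> C1 * exp ((2 * pi * \<beta> + \<epsilon>) * r)"
    using indicator_PL_bound[OF F indF(1) \<epsilon>] by blast
  obtain C2 where C2: "C2 \<ge> 0" "\<And>r. r \<ge> 0 \<Longrightarrow> norm (F (of_real r * cis (- pi / 2))) \<le> C2 * exp ((- 2 * pi * \<alpha> + \<epsilon>) * r)"
    using indicator_PL_bound[OF F indF(2) \<epsilon>] by blast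
  obtain C3 where C3: "C3 \<ge> 0" "\<And>r. r \<ge> 0 \<Longrightarrow> norm (H (of_real r * cis (pi / 2))) \<le> C3 * exp ((2 * pi * \<beta> + \<epsilon>) * r)"
    using indicator_PL_bound[OF H indH(1) \<epsilon>] by blast
  obtain C4 where C4: "C4 \<ge> 0" "\<And>r. r \<ge> 0 \<Longrightarrow> norm (H (of_real r * cis (- pi / 2))) \<le> C4 * exp ((- 2 * pi * \<alpha> + \<epsilon>) * r)"
    using indicator_PL_bound[OF H indH(2) \<epsilon>] by blast
  define C where "C = C1 + C2 + C3 + C4"
  obtain D1 \<tau>1 where D1: "\<And>z. norm (F z) \<le> D1 * exp (\<tau>1 * norm z)"
    using expF unfolding exponential_type_def by blast
  obtain D2 \<tau>2 where D2: "\<And>z. norm (H z) \<le> D2 * exp (\<tau>2 * norm z)"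
    using expH unfolding exponential_type_def by blast
  have "\<Phi> z = 0"
  proof (rule carlson[of \<Phi> \<kappa> "\<bar>D1\<bar> + \<bar>D2\<bar>" "\<bar>\<tau>1\<bar> + \<bar>\<tau>2\<bar> + \<bar>c\<bar>" C])
    show "\<Phi> holomorphic_on UNIV"
      unfolding \<Phi>_def by (intro holomorphic_intros F H)
    show "\<kappa> < pi" by fact
    show "\<Phi> (of_nat n) = 0" for n by (simp add: \<Phi>_def eq)
    fix w :: complex
    have "norm (F w) \<le> \<bar>D1\<bar> * exp ((\<bar>\<tau>1\<bar> + \<bar>\<tau>2\<bar>) * norm w)"
      by (rule order_trans[OF D1]) (auto intro!: mult_mono mult_right_mono)
    moreover have "norm (H w) \<le> \<bar>D2\<bar> * exp ((\<bar>\<tau>1\<bar> + \<bar>\<tau>2\<bar>) * norm w)"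
      by (rule order_trans[OF D2]) (auto intro!: mult_mono mult_right_mono)
    ultimately have "norm (F w - H w) \<le> (\<bar>D1\<bar> + \<bar>D2\<bar>) * exp ((\<bar>\<tau>1\<bar> + \<bar>\<tau>2\<bar>) * norm w)"
      using norm_triangle_ineq4[of "F w" "H w"] by (simp add: distrib_right)
    moreover have "norm (exp (\<i> * of_real c * w)) \<le> exp (\<bar>c\<bar> * norm w)"
    proof -
      have "- (c * Im w) \<le> \<bar>c\<bar> * \<bar>Im w\<bar>"
        using abs_ge_minus_self[of "c * Im w"] by (simp add: abs_mult)
      also have "\<dots> \<le> \<bar>c\<bar> * norm w" by (intro mult_left_mono abs_Im_le_cmod) auto
      finally show ?thesis by simp
    qed
    ultimately have "norm (\<Phi> w) \<le> (\<bar>D1\<bar> + \<bar>D2\<bar>) * exp ((\<bar>\<tau>1\<bar> + \<bar>\<tau>2\<bar>) * norm w) * exp (\<bar>c\<bar> * norm w)"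
      unfolding \<Phi>_def norm_mult by (intro mult_mono) auto
    then show "norm (\<Phi> w) \<le> (\<bar>D1\<bar> + \<bar>D2\<bar>) * exp ((\<bar>\<tau>1\<bar> + \<bar>\<tau>2\<bar> + \<bar>c\<bar>) * norm w)"
      by (simp add: mult.assoc mult_exp_exp distrib_right)
  next
    fix y :: real
    \<comment> \<open>The two half-axes have different rates \<open>h\<close>; the contribution - c
      y of the exponential factor brings both to \<kappa>.\<close>
    have axis: "norm (\<Phi> (\<i> * of_real y)) \<le> C * exp (\<kappa> * \<bar>y\<bar>)"
      if "norm (F (\<i> * of_real y)) \<le> A1 * exp (h * \<bar>y\<bar>)" "norm (H (\<i> * of_real y)) \<le> A2 * exp (h * \<bar>y\<bar>)"
        "A1 + A2 \<le> C" "h * \<bar>y\<bar> - c * y = \<kappa> * \<bar>y\<bar>" for A1 A2 h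
    proof -
      have "norm (F (\<i> * of_real y) - H (\<i> * of_real y)) \<le> (A1 + A2) * exp (h * \<bar>y\<bar>)"
        using that norm_triangle_ineq4[of "F (\<i> * of_real y)" "H (\<i> * of_real y)"] by (simp add: distrib_right)
      also have "\<dots> \<le> C * exp (h * \<bar>y\<bar>)" using that by (intro mult_right_mono) auto
      finally have "norm (\<Phi> (\<i> * of_real y)) \<le> C * exp (h * \<bar>y\<bar>) * exp (- (c * y))"
        by (simp add: \<Phi>_def norm_mult)
      then show ?thesis using that(4) by (simp add: mult.assoc mult_exp_exp)
    qed
    show "norm (\<Phi> (\<i> * of_real y)) \<le> C * exp (\<kappa> * \<bar>y\<bar>)"
    proof (cases "y \<ge> 0")
      case True
      show ?thesis
      proof (rule axis[of C1 "2 * pi * \<beta> + \<epsilon>" C3])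
        show "(2 * pi * \<beta> + \<epsilon>) * \<bar>y\<bar> - c * y = \<kappa> * \<bar>y\<bar>"
          using True by (simp add: c_def \<kappa>_def algebra_simps)
      qed (use True C1(2)[of y] C3(2)[of y] C2(1) C4(1) in \<open>simp_all add: cis_half C_def mult.commute\<close>)
    next
      case False
      show ?thesis
      proof (rule axis[of C2 "- 2 * pi * \<alpha> + \<epsilon>" C4])
        show "(- 2 * pi * \<alpha> + \<epsilon>) * \<bar>y\<bar> - c * y = \<kappa> * \<bar>y\<bar>"
          using False by (simp add: c_def \<kappa>_def algebra_simps)
      qed (use False C2(2)[of "- y"] C4(2)[of "- y"] C1(1) C3(1) in \<open>simp_all only: cis_half, simp_all add: C_def mult.commute\<close>)
    qed
  qed
  then show ?thesis by (simp add: \<Phi>_def)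
qed

section \<open>The transform and the Herglotz representation\<close>

definition exp_transform :: "real measure \<Rightarrow> (real \<Rightarrow> complex) \<Rightarrow> complex \<Rightarrow> complex" where
  "exp_transform \<mu> f z = (LINT x|\<mu>. f x * exp (- 2 * of_real pi * \<i> * of_real x * z))"

context
  fixes \<mu> :: "real measure" and \<alpha> \<beta> :: real and f :: "real \<Rightarrow> complex"
  assumes sets_mu [measurable_cong]: "sets \<mu> = sets borel"
    and AE_supp: "AE x in \<mu>. \<alpha> \<le> x \<and> x \<le> \<beta>"
    and int_f: "integrable \<mu> f"
begin

text \<open>The kernel has modulus exp (2 pi x Im z). Leaving \<open>s\<close> free lets one
  estimate serve the exponential type and both indicator values.\<close>

lemma norm_exp_transform_le:
  assumes s: "\<And>x. \<alpha> \<le> x \<Longrightarrow> x \<le> \<beta> \<Longrightarrow> 2 * pi * x * Im z \<le> s"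
  shows "norm (exp_transform \<mu> f z) \<le> (LINT x|\<mu>. norm (f x)) * exp s"
proof -
  have [measurable]: "f \<in> borel_measurable \<mu>" using int_f by auto
  have AE: "AE x in \<mu>. norm (f x * exp (- 2 * of_real pi * \<i> * of_real x * z)) \<le> norm (f x) * exp s"
    using AE_supp by eventually_elim (auto simp: norm_mult intro!: mult_left_mono s)
  have "integrable \<mu> (\<lambda>x. norm (f x) * exp s)" using int_f by auto
  moreover have "integrable \<mu> (\<lambda>x. norm (f x * exp (- 2 * of_real pi * \<i> * of_real x * z)))"
    by (rule Bochner_Integration.integrable_bound[OF calculation]) (use AE in auto)
  ultimately have "(LINT x|\<mu>. norm (f x * exp (- 2 * of_real pi * \<i> * of_real x * z))) \<le> (LINT x|\<mu>. norm (f x) * exp s)"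
    using AE by (intro integral_mono_AE)
  also have "\<dots> = (LINT x|\<mu>. norm (f x)) * exp s" by simp
  finally show ?thesis
    unfolding exp_transform_def by (rule order_trans[OF integral_norm_bound])
qed

lemma exponential_type_exp_transform: "exponential_type (exp_transform \<mu> f)"
  unfolding exponential_type_def
proof (intro exI allI)
  fix z
  have "2 * pi * x * Im z \<le> 2 * pi * (\<bar>\<alpha>\<bar> + \<bar>\<beta>\<bar>) * norm z" if "\<alpha> \<le> x" "x \<le> \<beta>" for x
  proof -
    have "x * Im z \<le> \<bar>x\<bar> * \<bar>Im z\<bar>" using abs_ge_self[of "x * Im z"] by (simp add: abs_mult)
    also have "\<dots> \<le> (\<bar>\<alpha>\<bar> + \<bar>\<beta>\<bar>) * norm z"
      using that by (intro mult_mono abs_Im_le_cmod) auto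
    finally have "(2 * pi) * (x * Im z) \<le> (2 * pi) * ((\<bar>\<alpha>\<bar> + \<bar>\<beta>\<bar>) * norm z)"
      by (rule mult_left_mono) auto
    then show ?thesis by (simp only: mult.assoc)
  qed
  then show "norm (exp_transform \<mu> f z) \<le> (LINT x|\<mu>. norm (f x)) * exp (2 * pi * (\<bar>\<alpha>\<bar> + \<bar>\<beta>\<bar>) * norm z)"
    by (rule norm_exp_transform_le)
qed

text \<open>On the positive imaginary axis the modulus of the kernel is largest at x = \<beta>, on
  the negative one at x = \<alpha>.\<close>

lemma indicator_exp_transform:
  "indicator_PL (exp_transform \<mu> f) (pi / 2) \<le> ereal (2 * pi * \<beta>)"
  "indicator_PL (exp_transform \<mu> f) (- pi / 2) \<le> ereal (- 2 * pi * \<alpha>)"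
proof -
  show "indicator_PL (exp_transform \<mu> f) (pi / 2) \<le> ereal (2 * pi * \<beta>)"
    by (rule indicator_PL_le, rule norm_exp_transform_le) (auto intro!: mult_right_mono)
  show "indicator_PL (exp_transform \<mu> f) (- pi / 2) \<le> ereal (- 2 * pi * \<alpha>)"
    by (rule indicator_PL_le, rule norm_exp_transform_le) (auto intro!: mult_right_mono)
qed

text \<open>Termwise integration of the exponential series gives a power series; since x is bounded
  by \<bar>\<alpha>\<bar> + \<bar>\<beta>\<bar>, its coefficients are of order \<rho>^n / n! and it
  converges everywhere.\<close>

lemma holomorphic_exp_transform: "exp_transform \<mu> f holomorphic_on UNIV"
proof -
  have [measurable]: "f \<in> borel_measurable \<mu>" using int_f by auto
  define \<rho> where "\<rho> = 2 * pi * (\<bar>\<alpha>\<bar> + \<bar>\<beta>\<bar>)"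
  define g where "g n x = (- 2 * of_real pi * \<i> * of_real x) ^ n / of_real (fact n)" for n and x :: real
  have g_le: "norm (g n x) \<le> \<rho> ^ n / fact n" if "\<alpha> \<le> x \<and> x \<le> \<beta>" for n x
  proof -
    have "norm (- 2 * of_real pi * \<i> * of_real x) \<le> \<rho>"
    proof -
      have "\<bar>x\<bar> \<le> \<bar>\<alpha>\<bar> + \<bar>\<beta>\<bar>" using that by linarith
      then show ?thesis by (simp add: norm_mult \<rho>_def)
    qed
    then have "norm (- 2 * of_real pi * \<i> * of_real x) ^ n \<le> \<rho> ^ n"
      by (intro power_mono) auto
    then show ?thesis
      unfolding g_def norm_divide norm_power by (simp add: divide_right_mono)
  qed
  have sums: "(\<lambda>n. (LINT x|\<mu>. f x * g n x) * w ^ n) sums exp_transform \<mu> f w" for w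
  proof -
    have AE_le: "AE x in \<mu>. \<forall>n. norm (f x * g n x * w ^ n) \<le> norm (f x) * ((\<rho> * norm w) ^ n / fact n)"
      using AE_supp
    proof eventually_elim
      case (elim x)
      have "norm (f x) * (norm (g n x) * norm w ^ n) \<le> norm (f x) * (\<rho> ^ n / fact n * norm w ^ n)" for n
        by (intro mult_left_mono mult_right_mono g_le elim) auto
      then show ?case
        by (simp add: norm_mult norm_power power_mult_distrib mult.assoc)
    qed
    have exps: "summable (\<lambda>n. c * ((\<rho> * norm w) ^ n / fact n))" for c
      using summable_exp[of "\<rho> * norm w"] by (intro summable_mult) (simp add: field_simps)
    have int: "integrable \<mu> (\<lambda>x. f x * g n x * w ^ n)" for n
    proof (rule Bochner_Integration.integrable_bound)
      show "integrable \<mu> (\<lambda>x. norm (f x) * ((\<rho> * norm w) ^ n / fact n))" using int_f by auto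
      show "(\<lambda>x. f x * g n x * w ^ n) \<in> borel_measurable \<mu>" unfolding g_def by measurable
      show "AE x in \<mu>. norm (f x * g n x * w ^ n) \<le> norm (norm (f x) * ((\<rho> * norm w) ^ n / fact n))"
        using AE_le by eventually_elim (metis abs_ge_self order_trans real_norm_def)
    qed
    have "(\<lambda>n. LINT x|\<mu>. f x * g n x * w ^ n) sums (LINT x|\<mu>. (\<Sum>n. f x * g n x * w ^ n))"
    proof (rule sums_integral[OF int])
      show "AE x in \<mu>. summable (\<lambda>n. norm (f x * g n x * w ^ n))"
        using AE_le
        by eventually_elim (rule summable_comparison_test'[OF exps], auto)
      show "summable (\<lambda>n. LINT x|\<mu>. norm (f x * g n x * w ^ n))"
      proof (rule summable_comparison_test'[OF exps[of "LINT x|\<mu>. norm (f x)"]])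
        fix n
        have "(LINT x|\<mu>. norm (f x * g n x * w ^ n)) \<le> (LINT x|\<mu>. norm (f x) * ((\<rho> * norm w) ^ n / fact n))"
          using AE_le int_f by (intro integral_mono_AE integrable_norm int) auto
        then show "norm (LINT x|\<mu>. norm (f x * g n x * w ^ n)) \<le> (LINT x|\<mu>. norm (f x)) * ((\<rho> * norm w) ^ n / fact n)"
          by simp
      qed
    qed
    moreover have "(\<Sum>n. f x * g n x * w ^ n) = f x * exp (- 2 * of_real pi * \<i> * of_real x * w)" for x
    proof -
      have "(\<lambda>n. f x * ((- 2 * of_real pi * \<i> * of_real x * w) ^ n /\<^sub>R fact n)) sums
          (f x * exp (- 2 * of_real pi * \<i> * of_real x * w))"
        by (intro sums_mult exp_converges)
      moreover have "f x * ((- 2 * of_real pi * \<i> * of_real x * w) ^ n /\<^sub>R fact n) = f x * g n x * w ^ n" for n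
        unfolding g_def power_mult_distrib scaleR_conv_of_real by (simp add: field_simps)
      ultimately show ?thesis by (simp add: sums_iff)
    qed
    ultimately show ?thesis by (simp add: exp_transform_def)
  qed
  have "exp_transform \<mu> f holomorphic_on ball 0 r" for r
    by (rule power_series_holomorphic[where a = "\<lambda>n. LINT x|\<mu>. f x * g n x"]) (use sums in auto)
  then have "exp_transform \<mu> f holomorphic_on (\<Union>r. ball 0 r)"
    by (intro holomorphic_on_UN_open) auto
  moreover have "(\<Union>r. ball (0::complex) r) = UNIV"
    using gt_ex by auto
  ultimately show ?thesis by simp
qed

end

section \<open>Power series of \<open>mu_plus\<close>, of b and of Hardy functions\<close>

lemma mu_plus_sums:
  assumes "prob_space \<mu>" and sets: "sets \<mu> = sets borel" and z: "norm z < 1"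
  shows "(\<lambda>n. (LINT x|\<mu>. cis (- 2 * pi * real n * x)) * z ^ n) sums mu_plus \<mu> z"
proof -
  interpret prob_space \<mu> by fact
  have "(\<lambda>n. z ^ n * (LINT x|\<mu>. 1 * cis (- 2 * pi * real n * x))) sums
      (LINT x|\<mu>. 1 * (\<Sum>n. z ^ n * cis (- 2 * pi * real n * x)))"
    by (rule sums_integral_cis[OF sets]) (use z in \<open>auto simp: norm_power intro!: summable_geometric\<close>)
  moreover have "(\<Sum>n. z ^ n * cis (- 2 * pi * real n * x)) = 1 / (1 - z * cis (- 2 * pi * x))" for x
  proof -
    have "(\<lambda>n. (z * cis (- 2 * pi * x)) ^ n) sums (1 / (1 - z * cis (- 2 * pi * x)))"
      by (rule geometric_sums) (use z in \<open>simp add: norm_mult\<close>)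
    moreover have "(z * cis (- 2 * pi * x)) ^ n = z ^ n * cis (- 2 * pi * real n * x)" for n
      unfolding power_mult_distrib Complex.DeMoivre by (simp add: mult_ac)
    ultimately have "(\<lambda>n. z ^ n * cis (- 2 * pi * real n * x)) sums (1 / (1 - z * cis (- 2 * pi * x)))"
      by (simp only:)
    then show ?thesis by (rule sums_unique[symmetric])
  qed
  ultimately show ?thesis by (simp add: mu_plus_def mult.commute)
qed

text \<open>With \<zeta> on the circle, (\<zeta> + z) / (\<zeta> - z) = 2 / (1 - z / \<zeta>) - 1,
  and the total mass is 1.\<close>

lemma herglotz_integral:
  assumes "prob_space \<mu>" and sets[measurable_cong]: "sets \<mu> = sets borel" and z: "norm z < 1"
  shows "(LINT x|\<mu>. (cis (2 * pi * x) + z) / (cis (2 * pi * x) - z)) = 2 * mu_plus \<mu> z - 1"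
proof -
  interpret prob_space \<mu> by fact
  have ne: "norm (1 - z * cis (- 2 * pi * x)) \<ge> 1 - norm z" for x
    using norm_triangle_ineq2[of 1 "z * cis (- 2 * pi * x)"] by (simp add: norm_mult)
  define g where "g x = 1 / (1 - z * cis (- 2 * pi * x))" for x
  have int: "integrable \<mu> g"
  proof (rule integrable_const_bound[where B = "1 / (1 - norm z)"])
    have "norm (g x) \<le> 1 / (1 - norm z)" for x
      unfolding g_def norm_divide norm_one by (rule frac_le) (use ne[of x] z in auto)
    then show "AE x in \<mu>. norm (g x) \<le> 1 / (1 - norm z)" by simp
    show "g \<in> borel_measurable \<mu>" unfolding g_def by measurable
  qed
  have "(cis (2 * pi * x) + z) / (cis (2 * pi * x) - z) = 2 * g x - 1" for x
  proof -
    define c where "c = cis (2 * pi * x)"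
    define d where "d = cis (- 2 * pi * x)"
    have c: "c \<noteq> 0" "c - z \<noteq> 0" using z by (auto simp: c_def)
    have "c * d = 1" by (simp add: c_def d_def cis_mult)
    then have "d = 1 / c" using c by (simp add: eq_divide_eq mult.commute)
    then have "1 - z * d = (c - z) / c" using c by (simp add: field_simps)
    then have gx: "g x = c / (c - z)" unfolding g_def d_def[symmetric] by simp
    show ?thesis unfolding c_def[symmetric] gx using c by (simp add: field_simps)
  qed
  then have "(LINT x|\<mu>. (cis (2 * pi * x) + z) / (cis (2 * pi * x) - z)) = (LINT x|\<mu>. 2 * g x - 1)"
    by simp
  also have "\<dots> = 2 * (LINT x|\<mu>. g x) - 1"
    using int by (simp add: prob_space)
  finally show ?thesis by (simp add: mu_plus_def g_def)
qed

text \<open>Clearing denominators in (1 + b) / (1 - b) = 2 mu_plus - 1 gives (1 - b) mu_plus = 1. A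
  neighbourhood of 0 is enough to pass to power series.\<close>

lemma herglotz_fps:
  assumes \<mu>: "prob_space \<mu>" "sets \<mu> = sets borel" and b: "herglotz_inner_function \<mu> b"
  shows "(1 - fps_expansion b 0) * Abs_fps (\<lambda>n. LINT x|\<mu>. cis (- 2 * pi * real n * x)) = 1"
    and "fps_expansion (\<lambda>z. 1 / mu_plus \<mu> z) 0 = 1 - fps_expansion b 0"
proof -
  define M where "M = Abs_fps (\<lambda>n. LINT x|\<mu>. cis (- 2 * pi * real n * x))"
  have hol: "b holomorphic_on ball 0 1"
    using b by (simp add: herglotz_inner_function_def inner_function_def)
  have near: "\<forall>\<^sub>F z in nhds (0::complex). z \<in> ball 0 1"
    by (rule eventually_nhds_in_open) auto
  then have "\<forall>\<^sub>F z in nhds 0. (\<lambda>n. fps_nth M n * z ^ n) sums mu_plus \<mu> z"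
    by eventually_elim (use mu_plus_sums[OF \<mu>] in \<open>simp add: M_def\<close>)
  then have M: "mu_plus \<mu> has_fps_expansion M" by (rule has_fps_expansionI)
  have B: "(\<lambda>z. 1 - b z) has_fps_expansion (1 - fps_expansion b 0)"
    by (intro has_fps_expansion_diff has_fps_expansion_1 has_fps_expansion_fps_expansion[OF open_ball _ hol]) auto
  have eq: "(1 + b z) / (1 - b z) = 2 * mu_plus \<mu> z - 1" if "norm z < 1" for z
    using b that herglotz_integral[OF \<mu> that] by (simp add: herglotz_inner_function_def)
  have "mu_plus \<mu> 0 = 1"
    using \<mu> by (simp add: mu_plus_def prob_space.prob_space)
  then have "(1 + b 0) / (1 - b 0) = 1" using eq[of 0] by simp
  \<comment> \<open>For \<open>b 0 = 1\<close> the quotient would be 0, the default value of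
    division by 0.\<close>
  then have "b 0 \<noteq> 1" by auto
  have "isCont b 0"
    by (rule field_differentiable_imp_continuous_at, rule holomorphic_on_imp_differentiable_at[OF hol open_ball]) simp
  then have "\<forall>\<^sub>F z in nhds 0. b z \<noteq> 1"
    using \<open>b 0 \<noteq> 1\<close> tendsto_imp_eventually_ne[of b "b 0" "nhds 0" 1]
    by (simp add: isCont_def tendsto_at_iff_tendsto_nhds)
  with near have inv: "\<forall>\<^sub>F z in nhds 0. (1 - b z) * mu_plus \<mu> z = 1"
  proof eventually_elim
    case (elim z)
    then have "1 + b z = (2 * mu_plus \<mu> z - 1) * (1 - b z)" using eq[of z] by (simp add: divide_eq_eq)
    then have "2 * ((1 - b z) * mu_plus \<mu> z) = 2 * 1" by (simp add: algebra_simps)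
    then show ?case by (simp only: mult_cancel_left) simp
  qed
  have "(\<lambda>z. (1 - b z) * mu_plus \<mu> z) has_fps_expansion (1 - fps_expansion b 0) * M"
    by (rule has_fps_expansion_mult[OF B M])
  then have "(\<lambda>z. 1) has_fps_expansion (1 - fps_expansion b 0) * M"
    using inv by (subst (asm) has_fps_expansion_cong) auto
  then show "(1 - fps_expansion b 0) * Abs_fps (\<lambda>n. LINT x|\<mu>. cis (- 2 * pi * real n * x)) = 1"
    unfolding M_def[symmetric] using fps_expansion_unique_complex has_fps_expansion_1 by blast
  have "\<forall>\<^sub>F z in nhds 0. 1 - b z = 1 / mu_plus \<mu> z"
    using inv by eventually_elim (metis nonzero_eq_divide_eq mult_zero_right zero_neq_one)
  then have "(\<lambda>z. 1 / mu_plus \<mu> z) has_fps_expansion (1 - fps_expansion b 0)"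
    using B by (subst (asm) has_fps_expansion_cong) auto
  then show "fps_expansion (\<lambda>z. 1 / mu_plus \<mu> z) 0 = 1 - fps_expansion b 0"
    by (rule fps_expansion_eqI)
qed

text \<open>Square-summable coefficients are bounded, so comparison with a geometric series gives
  convergence on the disc.\<close>

lemma hardy_space_of_coeffs:
  assumes a: "summable (\<lambda>n. (norm (a n))\<^sup>2)"
  obtains G where "G \<in> hardy_space" "fps_expansion G 0 = Abs_fps a"
proof -
  define G where "G z = (\<Sum>n. a n * z ^ n)" for z
  have a0: "(\<lambda>n. (norm (a n))\<^sup>2) \<longlonglongrightarrow> 0" using a by (rule summable_LIMSEQ_zero)
  obtain K where K: "\<And>n. norm ((norm (a n))\<^sup>2) \<le> K"
    using convergent_imp_Bseq[OF convergentI[OF a0]] unfolding Bseq_def by auto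
  have a_le: "norm (a n) \<le> K + 1" for n
  proof -
    have "(norm (a n))\<^sup>2 \<le> K" using K[of n] by simp
    moreover have "2 * norm (a n) \<le> (norm (a n))\<^sup>2 + 1" using sum_squares_bound[of "norm (a n)" 1] by simp
    ultimately show ?thesis using norm_ge_zero[of "a n"] by linarith
  qed
  have sums: "(\<lambda>n. a n * z ^ n) sums G z" if "norm z < 1" for z
  proof -
    have "summable (\<lambda>n. (K + 1) * norm z ^ n)"
      using that by (intro summable_mult summable_geometric) auto
    then have "summable (\<lambda>n. a n * z ^ n)"
      by (rule summable_comparison_test') (auto simp: norm_mult norm_power intro!: mult_right_mono a_le)
    then show ?thesis by (simp add: G_def summable_sums)
  qed
  have hol: "G holomorphic_on ball 0 1"
    by (rule power_series_holomorphic[where a = a]) (use sums in auto)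
  have "\<forall>\<^sub>F z in nhds (0::complex). z \<in> ball 0 1"
    by (rule eventually_nhds_in_open) auto
  then have "G has_fps_expansion Abs_fps a"
    by (intro has_fps_expansionI) (auto elim!: eventually_mono intro!: sums)
  then have exp: "fps_expansion G 0 = Abs_fps a" by (rule fps_expansion_eqI)
  with hol a have "G \<in> hardy_space" by (simp add: hardy_space_def)
  then show ?thesis using exp by (rule that)
qed

lemma fps_expansion_mult:
  assumes "f holomorphic_on ball 0 1" "g holomorphic_on ball 0 1"
  shows "fps_expansion (\<lambda>z. f z * g z) 0 = fps_expansion f 0 * fps_expansion g 0"
  using assms by (intro fps_expansion_eqI has_fps_expansion_mult has_fps_expansion_fps_expansion[OF open_ball]) auto

theorem theorem2:
  fixes \<mu> :: "real measure" and \<alpha> \<beta> :: real and b F :: "complex \<Rightarrow> complex"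
  assumes "singular_circle_prob \<mu>"
    and "-1/2 \<le> \<alpha>" and "\<beta> \<le> 1/2" and "\<beta> - \<alpha> < 1"
    and "msupport \<mu> \<subseteq> {\<alpha>..\<beta>}"
    and "herglotz_inner_function \<mu> b"
    and "F holomorphic_on UNIV"
  shows "(\<exists>f. in_L2 \<mu> f \<and>
            (\<forall>z. F z = (LINT x|\<mu>. f x * exp (- 2 * of_real pi * \<i> * of_real x * z)))) \<longleftrightarrow>
         exponential_type F \<and>
         (indicator_PL F (pi / 2) \<le> ereal (2 * pi * \<beta>) \<and>
          indicator_PL F (- pi / 2) \<le> ereal (- 2 * pi * \<alpha>)) \<and>
         (\<exists>G\<in>model_space b. fps_expansion G 0 = G_series \<mu> F)"
proof -
  have \<mu>: "prob_space \<mu>" "sets \<mu> = sets borel"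
    using assms(1) by (auto simp: singular_circle_prob_def)
  interpret prob_space \<mu> by (rule \<mu>)
  have inner: "inner_function b" using assms(6) by (simp add: herglotz_inner_function_def)
  then have b_hol: "b holomorphic_on ball 0 1" by (simp add: inner_function_def)
  define B where "B = fps_expansion b 0"
  note herglotz = herglotz_fps[OF \<mu> assms(6), folded B_def]
  interpret clark_system \<mu> B
    by unfold_locales (use inner_function_coeff_correlation[OF inner] herglotz \<mu> in \<open>auto simp: B_def\<close>)
  have supp: "AE x in \<mu>. \<alpha> \<le> x \<and> x \<le> \<beta>"
  proof (rule AE_I)
    show "emeasure \<mu> (- msupport \<mu>) = 0" by (rule emeasure_compl_msupport[OF \<mu>(2)])
    show "{x \<in> space \<mu>. \<not> (\<alpha> \<le> x \<and> x \<le> \<beta>)} \<subseteq> - msupport \<mu>" using assms(5) by auto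
    have "closed (msupport \<mu>)"
      unfolding closed_def msupport_def openE open_subopen[of "- _"] by (auto simp: zero_less_iff_neq_zero)
    then show "- msupport \<mu> \<in> sets \<mu>" by (simp add: \<mu>(2) open_Compl)
  qed
  have integrable_L2: "integrable \<mu> f" if "in_L2 \<mu> f" for f
    using integrable_L2_inner[OF that, of "\<lambda>_. 1"] by (simp add: in_L2_def)
  \<comment> \<open>This links the two halves: the samples of the transform at the natural numbers
    are the data of the Kaczmarz algorithm.\<close>
  have at_nat: "exp_transform \<mu> f (of_nat n) = ip f (trig n)" for f n
  proof -
    have "exp (- 2 * of_real pi * \<i> * of_real x * of_nat n) = cnj (trig n x)" for x :: real
      by (simp add: trig_def cis_conv_exp exp_cnj mult_ac)
    then show ?thesis by (simp add: exp_transform_def L2_inner_def)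
  qed
  show ?thesis
  proof (intro iffI; (elim exE conjE)?)
    fix f assume f: "in_L2 \<mu> f" and "\<forall>z. F z = (LINT x|\<mu>. f x * exp (- 2 * of_real pi * \<i> * of_real x * z))"
    then have F: "F = exp_transform \<mu> f" by (auto simp: exp_transform_def)
    note tr = \<mu>(2) supp integrable_L2[OF f]
    have G: "fps_nth (G_series \<mu> F) = coef f"
      by (auto simp: G_series_def herglotz coef_def F at_nat)
    obtain G where G: "G \<in> hardy_space" "fps_expansion G 0 = G_series \<mu> F"
      using hardy_space_of_coeffs[OF summable_norm2_coef[OF f]] G by (metis fps_nth_inverse)
    have "hardy_inner G (\<lambda>z. b z * h z) = 0" if h: "h \<in> hardy_space" for h
    proof -
      have "(\<lambda>k. coef f k * cnj (fps_nth (B * fps_expansion h 0) k)) sums 0"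
        using h by (intro orthogonal_to_multiples summable_norm2_coef coef_orthogonal f) (simp add: hardy_space_def)
      moreover have "fps_expansion (\<lambda>z. b z * h z) 0 = B * fps_expansion h 0"
        unfolding B_def using h by (intro fps_expansion_mult b_hol) (simp add: hardy_space_def)
      ultimately show ?thesis
        using \<open>fps_nth (G_series \<mu> F) = coef f\<close> by (simp add: hardy_inner_def G(2) sums_iff)
    qed
    then have "G \<in> model_space b" using G(1) by (simp add: model_space_def)
    then show "exponential_type F \<and>
         (indicator_PL F (pi / 2) \<le> ereal (2 * pi * \<beta>) \<and>
          indicator_PL F (- pi / 2) \<le> ereal (- 2 * pi * \<alpha>)) \<and>
         (\<exists>G\<in>model_space b. fps_expansion G 0 = G_series \<mu> F)"
      using G(2) exponential_type_exp_transform[OF tr] indicator_exp_transform[OF tr] F by auto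
  next
    assume expF: "exponential_type F"
      and ind: "indicator_PL F (pi / 2) \<le> ereal (2 * pi * \<beta>)" "indicator_PL F (- pi / 2) \<le> ereal (- 2 * pi * \<alpha>)"
      and "\<exists>G\<in>model_space b. fps_expansion G 0 = G_series \<mu> F"
    then obtain G where G: "G \<in> model_space b" "fps_expansion G 0 = G_series \<mu> F" by blast
    define a where "a = fps_nth (G_series \<mu> F)"
    have a: "summable (\<lambda>k. (norm (a k))\<^sup>2)"
      using G by (simp add: model_space_def hardy_space_def a_def)
    have orth: "(\<lambda>k. a k * cnj (shifted n k)) sums 0" for n
    proof -
      have expn: "fps_expansion (\<lambda>z::complex. z ^ n) 0 = fps_X ^ n"
        by (intro fps_expansion_eqI has_fps_expansion_fps_X_power)
      have "(\<lambda>z. z ^ n) \<in> hardy_space"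
        unfolding hardy_space_def
        by (auto intro!: holomorphic_intros summable_finite[of "{n}"] simp: expn fps_X_power_nth split: if_splits)
      then have "hardy_inner G (\<lambda>z. b z * z ^ n) = 0" using G(1) by (auto simp: model_space_def)
      moreover have "fps_expansion (\<lambda>z. b z * z ^ n) 0 = fps_X ^ n * B"
        unfolding B_def by (subst fps_expansion_mult[OF b_hol]) (auto intro!: holomorphic_intros simp: expn mult.commute)
      ultimately have "(\<Sum>k. a k * cnj (shifted n k)) = 0"
        by (simp add: hardy_inner_def G(2) a_def shifted_def)
      \<comment> \<open>Convergence needs its own proof, since \<open>hardy_inner\<close> is a
        \<open>suminf\<close> and its value 0 alone does not yield \<open>sums 0\<close>.\<close>
      moreover have "summable (\<lambda>k. a k * cnj (shifted n k))"
      proof (rule summable_comparison_test'[OF summable_add[OF a summable_norm2_shifted[of n]]])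
        fix k
        show "norm (a k * cnj (shifted n k)) \<le> (norm (a k))\<^sup>2 + (norm (shifted n k))\<^sup>2"
          using sum_squares_bound[of "norm (a k)" "norm (shifted n k)"]
            mult_nonneg_nonneg[OF norm_ge_zero[of "a k"] norm_ge_zero[of "shifted n k"]]
          unfolding norm_mult complex_mod_cnj by linarith
      qed
      ultimately show ?thesis by (simp add: sums_iff)
    qed
    obtain f where f: "in_L2 \<mu> f" and ip_f: "\<And>m. ip f (trig m) = (\<Sum>k\<in>{0..m}. a k * moment (m - k))"
      using coef_surjective[OF a orth] by blast
    \<comment> \<open>Multiplying \<open>G_series\<close> by the moment series cancels 1 / mu_plus
      and returns the samples of \<open>F\<close>.\<close>
    have F_nat: "ip f (trig m) = F (of_nat m)" for m
    proof -
      have "G_series \<mu> F * Abs_fps moment = Abs_fps (\<lambda>n. F (of_nat n)) * ((1 - B) * Abs_fps moment)"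
        by (simp add: G_series_def herglotz mult_ac)
      then have "fps_nth (G_series \<mu> F * Abs_fps moment) m = F (of_nat m)"
        by (simp add: clark_eq')
      then show ?thesis by (simp add: ip_f a_def fps_mult_nth)
    qed
    note tr = \<mu>(2) supp integrable_L2[OF f]
    have "F z = exp_transform \<mu> f z" for z
      by (rule carlson_indicator[OF assms(7) holomorphic_exp_transform[OF tr] expF exponential_type_exp_transform[OF tr]
            ind indicator_exp_transform[OF tr] assms(4)]) (simp add: at_nat F_nat)
    with f show "\<exists>f. in_L2 \<mu> f \<and> (\<forall>z. F z = (LINT x|\<mu>. f x * exp (- 2 * of_real pi * \<i> * of_real x * z)))"
      by (auto simp: exp_transform_def)
  qed
qed

end
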